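(* Let $(X,m)$ be a median algebra satisfying $(T^m_2)$. Denote by $\nu_m\colon X\hookrightarrow\widehat X$ the proper compactification of $(X,\tau_{\mathrm m})$ induced by the (precompact) Hausdorff median uniformity $\mathcal U_{\mathrm m}$, i.e. $\widehat X$ is the Hausdorff completion of $(X,\mathcal U_{\mathrm m})$. Then: (1) $\widehat X$ admits a continuous median operation $\widehat m$ which extends the median of $X$, and $\widehat X$ is a compact Hausdorff median algebra. (2) $\widehat X$ is the minimal median compactification of $(X,\tau_{\mathrm m})$: if $K$ is any proper median compactification of $(X,\tau_{\mathrm m})$ (with $X$ identified with its image in $K$), then there exists a unique continuous surjective median homomorphism $f\colon K\to\widehat X$ such that $f(x)=x$ for every $x\in X$.
   Context: A median algebra is a set $X$ with a ternary operation $m\colon X^3\to X$ that is symmetric in all variables and satisfies $m(a,b,b)=b$ and $m(m(a,x,b),x,c)=m(a,x,m(b,x,c))$. Intervals: $[x,y]=\{z: m(x,y,z)=z\}$. A subalgebra is a chain if it carries a linear order $\le$ for which $m(a,b,c)=b$ whenever $a\le b\le c$. A nontrivial chain interval is an interval $[u,v]$ with $u\ne v$ that is a chain. Canonical retraction: $\phi_{u,v}\colon X\to[u,v]$, $\phi_{u,v}(z)=m(u,z,v)$. Branches: $B^u_v=\{x: m(u,x,v)\neq v\}$, $B^v_u=\{x: m(u,x,v)\ne u\}$. The median uniformity $\mathcal U_{\mathrm m}$ on $X$ is the covering uniformity having as a uniform subbase all two-member covers $\{B^u_v,B^v_u\}$, where $[u,v]$ runs over all nontrivial chain intervals: a cover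 belongs to $\mathcal U_{\mathrm m}$ iff it is refined by a finite common refinement (wedge) of such covers. Its topology is denoted $\tau_{\mathrm m}$ (the intrinsic median topology). $X\in(T^m_2)$ means: for all distinct $x,y\in X$ there is a chain interval $[u,v]$ with $u\neq v$ and $\{\phi_{u,v}(x),\phi_{u,v}(y)\}=\{u,v\}$; this is equivalent to $\mathcal U_{\mathrm m}$ being Hausdorff. A topological median algebra is a topological space with a continuous median operation. A median compactification of a topological median algebra $X$ is a pair $(K,\eta)$ where $K$ is a compact Hausdorff topological median algebra and $\eta\colon X\to K$ is a continuous median-preserving map with dense image; it is proper if $\eta$ is a topological embedding. *)

theory Defs
  imports "HOL-Analysis.Analysis"
begin

section \<open>Median algebras\<close>

locale median_algebra =
  fixes X :: "'a set" and m :: "'a \<Rightarrow> 'a \<Rightarrow> 'a \<Rightarrow> 'a"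
  assumes closed: "\<lbrakk>a \<in> X; b \<in> X; c \<in> X\<rbrakk> \<Longrightarrow> m a b c \<in> X"
    and sym12: "\<lbrakk>a \<in> X; b \<in> X; c \<in> X\<rbrakk> \<Longrightarrow> m a b c = m b a c"
    and sym23: "\<lbrakk>a \<in> X; b \<in> X; c \<in> X\<rbrakk> \<Longrightarrow> m a b c = m a c b"
    and majority: "\<lbrakk>a \<in> X; b \<in> X\<rbrakk> \<Longrightarrow> m a b b = b"
    and assoc: "\<lbrakk>a \<in> X; b \<in> X; c \<in> X; x \<in> X\<rbrakk> \<Longrightarrow> m (m a x b) x c = m a x (m b x c)"

definition median_hom ::
  "'a set \<Rightarrow> ('a \<Rightarrow> 'a \<Rightarrow> 'a \<Rightarrow> 'a) \<Rightarrow> 'b set \<Rightarrow> ('b \<Rightarrow> 'b \<Rightarrow> 'b \<Rightarrow> 'b) \<Rightarrow> ('a \<Rightarrow> 'b) \<Rightarrow> bool"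
  where "median_hom X m Y n f \<longleftrightarrow>
    f \<in> X \<rightarrow> Y \<and> (\<forall>x\<in>X. \<forall>y\<in>X. \<forall>z\<in>X. f (m x y z) = n (f x) (f y) (f z))"

definition median_interval ::
  "'a set \<Rightarrow> ('a \<Rightarrow> 'a \<Rightarrow> 'a \<Rightarrow> 'a) \<Rightarrow> 'a \<Rightarrow> 'a \<Rightarrow> 'a set"
  where "median_interval X m x y = {z \<in> X. m x y z = z}"

definition median_subalgebra :: "'a set \<Rightarrow> ('a \<Rightarrow> 'a \<Rightarrow> 'a \<Rightarrow> 'a) \<Rightarrow> 'a set \<Rightarrow> bool"
  where "median_subalgebra X m C \<longleftrightarrow>
    C \<subseteq> X \<and> (\<forall>a\<in>C. \<forall>b\<in>C. \<forall>c\<in>C. m a b c \<in> C)"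

definition median_chain :: "'a set \<Rightarrow> ('a \<Rightarrow> 'a \<Rightarrow> 'a \<Rightarrow> 'a) \<Rightarrow> 'a set \<Rightarrow> bool"
  where "median_chain X m C \<longleftrightarrow> median_subalgebra X m C \<and>
    (\<exists>r. linear_order_on C r \<and> (\<forall>a b c. (a, b) \<in> r \<and> (b, c) \<in> r \<longrightarrow> m a b c = b))"

definition nontrivial_chain_interval ::
  "'a set \<Rightarrow> ('a \<Rightarrow> 'a \<Rightarrow> 'a \<Rightarrow> 'a) \<Rightarrow> 'a \<Rightarrow> 'a \<Rightarrow> bool"
  where "nontrivial_chain_interval X m u v \<longleftrightarrow>
    u \<in> X \<and> v \<in> X \<and> u \<noteq> v \<and> median_chain X m (median_interval X m u v)"

definition median_retraction :: "('a \<Rightarrow> 'a \<Rightarrow> 'a \<Rightarrow> 'a) \<Rightarrow> 'a \<Rightarrow> 'a \<Rightarrow> 'a \<Rightarrow> 'a"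
  where "median_retraction m u v z = m u z v"

text \<open>In the usual notation, \<open>branch X m u v\<close> is the branch with superscript \<open>u\<close> and subscript \<open>v\<close>.
  The opposite branch is \<open>branch X m v u\<close>, by the symmetry of \<open>m\<close>.\<close>

definition branch :: "'a set \<Rightarrow> ('a \<Rightarrow> 'a \<Rightarrow> 'a \<Rightarrow> 'a) \<Rightarrow> 'a \<Rightarrow> 'a \<Rightarrow> 'a set"
  where "branch X m u v = {x \<in> X. m u x v \<noteq> v}"

definition T2_median :: "'a set \<Rightarrow> ('a \<Rightarrow> 'a \<Rightarrow> 'a \<Rightarrow> 'a) \<Rightarrow> bool"
  where "T2_median X m \<longleftrightarrow>
    (\<forall>x\<in>X. \<forall>y\<in>X. x \<noteq> y \<longrightarrow>
      (\<exists>u v. nontrivial_chain_interval X m u v \<and>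
             {median_retraction m u v x, median_retraction m u v y} = {u, v}))"


section \<open>Covering uniformities\<close>

definition is_cover :: "'a set \<Rightarrow> 'a set set \<Rightarrow> bool"
  where "is_cover X C \<longleftrightarrow> C \<subseteq> Pow X \<and> \<Union>C = X"

definition cover_refines :: "'a set set \<Rightarrow> 'a set set \<Rightarrow> bool"
  where "cover_refines C D \<longleftrightarrow> (\<forall>A\<in>C. \<exists>B\<in>D. A \<subseteq> B)"

text \<open>Common refinement of a family of covers; for the empty family it is the cover \<open>{X}\<close>.\<close>

definition cover_wedge :: "'a set \<Rightarrow> 'a set set set \<Rightarrow> 'a set set"
  where "cover_wedge X F = {X \<inter> (\<Inter>C\<in>F. s C) | s. \<forall>C\<in>F. s C \<in> C}"

definition uniformity_generated :: "'a set \<Rightarrow> 'a set set set \<Rightarrow> 'a set set set"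
  where "uniformity_generated X S =
    {C. is_cover X C \<and> (\<exists>F. finite F \<and> F \<subseteq> S \<and> cover_refines (cover_wedge X F) C)}"

definition cover_star :: "'a set set \<Rightarrow> 'a \<Rightarrow> 'a set"
  where "cover_star C x = \<Union>{A \<in> C. x \<in> A}"

definition uniform_topology :: "'a set \<Rightarrow> 'a set set set \<Rightarrow> 'a topology"
  where "uniform_topology X U =
    topology (\<lambda>G. G \<subseteq> X \<and> (\<forall>x\<in>G. \<exists>C\<in>U. cover_star C x \<subseteq> G))"

definition median_uniformity :: "'a set \<Rightarrow> ('a \<Rightarrow> 'a \<Rightarrow> 'a \<Rightarrow> 'a) \<Rightarrow> 'a set set set"
  where "median_uniformity X m =
    uniformity_generated X {{branch X m u v, branch X m v u} | u v. nontrivial_chain_interval X m u v}"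

definition median_topology :: "'a set \<Rightarrow> ('a \<Rightarrow> 'a \<Rightarrow> 'a \<Rightarrow> 'a) \<Rightarrow> 'a topology"
  where "median_topology X m = uniform_topology X (median_uniformity X m)"


section \<open>The Hausdorff completion of a covering uniformity\<close>

text \<open>The points of the completion are the minimal Cauchy filters on \<open>X\<close>, the construction of
  Bourbaki. Filters on \<open>X\<close> are represented by filters on the ambient type that contain \<open>X\<close>. Note
  that \<open>F \<le> G\<close> means that \<open>F\<close> is finer than \<open>G\<close>, that is, \<open>F\<close> contains more sets.\<close>

definition uniform_cauchy_filter :: "'a set \<Rightarrow> 'a set set set \<Rightarrow> 'a filter \<Rightarrow> bool"
  where "uniform_cauchy_filter X U F \<longleftrightarrow>
    F \<noteq> bot \<and> (\<forall>\<^sub>F x in F. x \<in> X) \<and> (\<forall>C\<in>U. \<exists>A\<in>C. \<forall>\<^sub>F x in F. x \<in> A)"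

definition hausdorff_completion :: "'a set \<Rightarrow> 'a set set set \<Rightarrow> 'a filter set"
  where "hausdorff_completion X U =
    {F. uniform_cauchy_filter X U F \<and> (\<forall>G. uniform_cauchy_filter X U G \<and> F \<le> G \<longrightarrow> G = F)}"

definition completion_set :: "'a set \<Rightarrow> 'a set set set \<Rightarrow> 'a set \<Rightarrow> 'a filter set"
  where "completion_set X U A = {F \<in> hausdorff_completion X U. \<forall>\<^sub>F x in F. x \<in> A}"

definition completion_uniformity :: "'a set \<Rightarrow> 'a set set set \<Rightarrow> 'a filter set set set"
  where "completion_uniformity X U =
    {D. is_cover (hausdorff_completion X U) D \<and> (\<exists>C\<in>U. cover_refines (completion_set X U ` C) D)}"

definition completion_topology :: "'a set \<Rightarrow> 'a set set set \<Rightarrow> 'a filter topology"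
  where "completion_topology X U = uniform_topology (hausdorff_completion X U) (completion_uniformity X U)"

text \<open>The canonical map sends a point to its neighbourhood filter.\<close>

definition completion_map :: "'a set \<Rightarrow> 'a set set set \<Rightarrow> 'a \<Rightarrow> 'a filter"
  where "completion_map X U x = nhdsin (uniform_topology X U) x"


section \<open>Median compactifications\<close>

definition topological_median_algebra :: "'a topology \<Rightarrow> ('a \<Rightarrow> 'a \<Rightarrow> 'a \<Rightarrow> 'a) \<Rightarrow> bool"
  where "topological_median_algebra T m \<longleftrightarrow>
    median_algebra (topspace T) m \<and>
    continuous_map (prod_topology T (prod_topology T T)) T (\<lambda>(x, y, z). m x y z)"

definition median_compactification ::
  "'a topology \<Rightarrow> ('a \<Rightarrow> 'a \<Rightarrow> 'a \<Rightarrow> 'a) \<Rightarrow> 'k topology \<Rightarrow> ('k \<Rightarrow> 'k \<Rightarrow> 'k \<Rightarrow> 'k) \<Rightarrow> ('a \<Rightarrow> 'k) \<Rightarrow> bool"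
  where "median_compactification T m K n \<eta> \<longleftrightarrow>
    topological_median_algebra T m \<and>
    topological_median_algebra K n \<and> compact_space K \<and> Hausdorff_space K \<and>
    continuous_map T K \<eta> \<and> median_hom (topspace T) m (topspace K) n \<eta> \<and>
    K closure_of (\<eta> ` topspace T) = topspace K"

definition proper_median_compactification ::
  "'a topology \<Rightarrow> ('a \<Rightarrow> 'a \<Rightarrow> 'a \<Rightarrow> 'a) \<Rightarrow> 'k topology \<Rightarrow> ('k \<Rightarrow> 'k \<Rightarrow> 'k \<Rightarrow> 'k) \<Rightarrow> ('a \<Rightarrow> 'k) \<Rightarrow> bool"
  where "proper_median_compactification T m K n \<eta> \<longleftrightarrow>
    median_compactification T m K n \<eta> \<and> embedding_map T K \<eta>"


section \<open>The topologies are well defined\<close>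

lemma openin_uniform_topology:
  assumes "U \<noteq> {}"
    and "\<And>C D. \<lbrakk>C \<in> U; D \<in> U\<rbrakk> \<Longrightarrow> \<exists>E\<in>U. cover_refines E C \<and> cover_refines E D"
  shows "openin (uniform_topology X U) G \<longleftrightarrow>
    G \<subseteq> X \<and> (\<forall>x\<in>G. \<exists>C\<in>U. cover_star C x \<subseteq> G)"
proof -
  have star: "cover_star E x \<subseteq> cover_star C x" if "cover_refines E C" for E C :: "'a set set" and x
    using that unfolding cover_refines_def cover_star_def by blast
  have "istopology (\<lambda>G. G \<subseteq> X \<and> (\<forall>x\<in>G. \<exists>C\<in>U. cover_star C x \<subseteq> G))"
    unfolding istopology_def
  proof (intro conjI allI impI ballI)
    fix S T x
    assume S: "S \<subseteq> X \<and> (\<forall>x\<in>S. \<exists>C\<in>U. cover_star C x \<subseteq> S)"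
      and T: "T \<subseteq> X \<and> (\<forall>x\<in>T. \<exists>C\<in>U. cover_star C x \<subseteq> T)" and x: "x \<in> S \<inter> T"
    obtain C D where "C \<in> U" "D \<in> U" "cover_star C x \<subseteq> S" "cover_star D x \<subseteq> T"
      using S T x by blast
    then show "\<exists>C\<in>U. cover_star C x \<subseteq> S \<inter> T"
      using assms(2)[of C D] star by (meson Int_greatest order_trans)
  next
    fix K x
    assume "\<forall>S\<in>K. S \<subseteq> X \<and> (\<forall>x\<in>S. \<exists>C\<in>U. cover_star C x \<subseteq> S)" "x \<in> \<Union>K"
    then show "\<exists>C\<in>U. cover_star C x \<subseteq> \<Union>K"
      by (meson Union_iff Union_upper order_trans)
  qed blast+
  then show ?thesis
    by (simp add: uniform_topology_def)
qed

lemma topspace_uniform_topology: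
  assumes "U \<noteq> {}" "\<And>C. C \<in> U \<Longrightarrow> is_cover X C"
    and "\<And>C D. \<lbrakk>C \<in> U; D \<in> U\<rbrakk> \<Longrightarrow> \<exists>E\<in>U. cover_refines E C \<and> cover_refines E D"
  shows "topspace (uniform_topology X U) = X"
proof -
  have "cover_star C x \<subseteq> X" if "C \<in> U" for C x
    using assms(2)[OF that] by (auto simp: cover_star_def is_cover_def)
  then have "openin (uniform_topology X U) X"
    using assms(1) by (auto simp: openin_uniform_topology[OF assms(1,3)])
  moreover have "topspace (uniform_topology X U) \<subseteq> X"
    using openin_uniform_topology[of U X, OF assms(1,3)] openin_topspace by blast
  ultimately show ?thesis
    by (simp add: openin_subset subset_antisym)
qed

lemma is_cover_wedge:
  assumes "\<And>C. C \<in> F \<Longrightarrow> is_cover X C"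
  shows "is_cover X (cover_wedge X F)"
proof -
  have "x \<in> \<Union>(cover_wedge X F)" if x: "x \<in> X" for x
  proof -
    have "\<exists>A. A \<in> C \<and> x \<in> A" if "C \<in> F" for C
    proof -
      have "\<Union>C = X"
        using assms[OF that] by (simp add: is_cover_def)
      then show ?thesis
        using x by blast
    qed
    then have "\<forall>C\<in>F. \<exists>A. A \<in> C \<and> x \<in> A" by blast
    from bchoice[OF this] obtain s where s: "\<forall>C\<in>F. s C \<in> C \<and> x \<in> s C" by blast
    then have "X \<inter> (\<Inter>C\<in>F. s C) \<in> cover_wedge X F"
      unfolding cover_wedge_def by blast
    moreover have "x \<in> X \<inter> (\<Inter>C\<in>F. s C)"
      using s x by simp
    ultimately show ?thesis
      by (rule UnionI)
  qed
  moreover have "A \<subseteq> X" if "A \<in> cover_wedge X F" for A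
    using that by (auto simp: cover_wedge_def)
  ultimately show ?thesis
    unfolding is_cover_def by blast
qed

lemma cover_wedge_antimono: "F \<subseteq> G \<Longrightarrow> cover_refines (cover_wedge X G) (cover_wedge X F)"
  unfolding cover_refines_def
proof
  fix A assume FG: "F \<subseteq> G" and "A \<in> cover_wedge X G"
  then obtain s where s: "A = X \<inter> (\<Inter>C\<in>G. s C)" "\<forall>C\<in>G. s C \<in> C"
    by (auto simp: cover_wedge_def)
  have "X \<inter> (\<Inter>C\<in>F. s C) \<in> cover_wedge X F"
    using s(2) FG unfolding cover_wedge_def by blast
  moreover have "A \<subseteq> X \<inter> (\<Inter>C\<in>F. s C)"
    using s(1) FG by blast
  ultimately show "\<exists>B\<in>cover_wedge X F. A \<subseteq> B" by blast
qed

lemma cover_refines_trans: "cover_refines C D \<Longrightarrow> cover_refines D E \<Longrightarrow> cover_refines C E"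
  unfolding cover_refines_def by (meson subset_trans)

lemma uniformity_generated_nonempty: "uniformity_generated X S \<noteq> {}"
proof -
  have "{X} \<in> uniformity_generated X S"
    by (auto simp: uniformity_generated_def is_cover_def cover_refines_def cover_wedge_def
        intro!: exI[of _ "{}"])
  then show ?thesis by blast
qed

lemma uniformity_generated_directed:
  assumes S: "\<And>C. C \<in> S \<Longrightarrow> is_cover X C"
    and "C \<in> uniformity_generated X S" "D \<in> uniformity_generated X S"
  shows "\<exists>E\<in>uniformity_generated X S. cover_refines E C \<and> cover_refines E D"
proof -
  obtain F G where F: "finite F" "F \<subseteq> S" "cover_refines (cover_wedge X F) C"
    and G: "finite G" "G \<subseteq> S" "cover_refines (cover_wedge X G) D"
    using assms(2,3) by (auto simp: uniformity_generated_def)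
  have "cover_wedge X (F \<union> G) \<in> uniformity_generated X S"
    unfolding uniformity_generated_def
  proof (intro CollectI conjI exI)
    show "is_cover X (cover_wedge X (F \<union> G))"
      by (rule is_cover_wedge) (use F(2) G(2) S in auto)
    show "finite (F \<union> G)" "F \<union> G \<subseteq> S" using F G by auto
    show "cover_refines (cover_wedge X (F \<union> G)) (cover_wedge X (F \<union> G))"
      by (auto simp: cover_refines_def)
  qed
  then show ?thesis
    using F(3) G(3) cover_refines_trans[OF cover_wedge_antimono, OF Un_upper1]
      cover_refines_trans[OF cover_wedge_antimono, OF Un_upper2] by blast
qed

lemma is_cover_completion_set:
  assumes "C \<in> U" shows "is_cover (hausdorff_completion X U) (completion_set X U ` C)"
proof -
  have "\<exists>A\<in>C. F \<in> completion_set X U A" if "F \<in> hausdorff_completion X U" for F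
    using that assms by (simp add: completion_set_def hausdorff_completion_def uniform_cauchy_filter_def)
  moreover have "completion_set X U A \<subseteq> hausdorff_completion X U" for A
    by (auto simp: completion_set_def)
  ultimately show ?thesis
    unfolding is_cover_def by blast
qed

lemma completion_set_mono:
  assumes "A \<subseteq> B" shows "completion_set X U A \<subseteq> completion_set X U B"
proof
  fix F assume F: "F \<in> completion_set X U A"
  then have "\<forall>\<^sub>F x in F. x \<in> A" by (simp add: completion_set_def)
  then have "\<forall>\<^sub>F x in F. x \<in> B"
    by (rule eventually_mono) (use assms in blast)
  then show "F \<in> completion_set X U B"
    using F by (simp add: completion_set_def)
qed

lemma completion_uniformity_directed:
  assumes U: "\<And>C D. \<lbrakk>C \<in> U; D \<in> U\<rbrakk> \<Longrightarrow> \<exists>E\<in>U. cover_refines E C \<and> cover_refines E D"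
    and "C \<in> completion_uniformity X U" "D \<in> completion_uniformity X U"
  shows "\<exists>E\<in>completion_uniformity X U. cover_refines E C \<and> cover_refines E D"
proof -
  obtain A B where A: "A \<in> U" "cover_refines (completion_set X U ` A) C"
    and B: "B \<in> U" "cover_refines (completion_set X U ` B) D"
    using assms(2,3) by (auto simp: completion_uniformity_def)
  obtain E where E: "E \<in> U" "cover_refines E A" "cover_refines E B"
    using U[OF A(1) B(1)] by blast
  have mono: "cover_refines (completion_set X U ` E) (completion_set X U ` C)"
    if EC: "cover_refines E C" for C
    unfolding cover_refines_def
  proof
    fix P assume "P \<in> completion_set X U ` E"
    then obtain A where A: "A \<in> E" "P = completion_set X U A" by (elim imageE)
    then obtain B where B: "B \<in> C" "A \<subseteq> B"
      using EC by (auto simp: cover_refines_def)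
    show "\<exists>Q\<in>completion_set X U ` C. P \<subseteq> Q"
      using completion_set_mono[OF B(2), of X U] B(1) A(2) by auto
  qed
  have "is_cover (hausdorff_completion X U) (completion_set X U ` E)"
    by (rule is_cover_completion_set[OF E(1)])
  then have "completion_set X U ` E \<in> completion_uniformity X U"
    using E(1) by (auto simp: completion_uniformity_def cover_refines_def)
  moreover have "cover_refines (completion_set X U ` E) C" "cover_refines (completion_set X U ` E) D"
    using cover_refines_trans[OF mono[OF E(2)] A(2)] cover_refines_trans[OF mono[OF E(3)] B(2)]
    by simp_all
  ultimately show ?thesis
    by blast
qed

lemma completion_uniformity_nonempty:
  assumes "U \<noteq> {}" shows "completion_uniformity X U \<noteq> {}"
proof -
  obtain C where "C \<in> U" using assms by blast
  moreover from this have "is_cover (hausdorff_completion X U) (completion_set X U ` C)"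
    by (rule is_cover_completion_set)
  ultimately have "completion_set X U ` C \<in> completion_uniformity X U"
    by (auto simp: completion_uniformity_def cover_refines_def)
  then show ?thesis by blast
qed

lemma (in median_algebra) is_cover_branches:
  assumes "nontrivial_chain_interval X m u v"
  shows "is_cover X {branch X m u v, branch X m v u}"
proof -
  have "m v x u = m u x v" if "x \<in> X" for x
    using that assms sym12[of v x u] sym23[of x v u] sym12[of x u v]
    by (simp add: nontrivial_chain_interval_def)
  then show ?thesis
    using assms by (auto simp: is_cover_def branch_def nontrivial_chain_interval_def)
qed

lemma (in median_algebra) median_uniformity_directed:
  "\<lbrakk>C \<in> median_uniformity X m; D \<in> median_uniformity X m\<rbrakk> \<Longrightarrow>
    \<exists>E\<in>median_uniformity X m. cover_refines E C \<and> cover_refines E D"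
  unfolding median_uniformity_def
  by (rule uniformity_generated_directed) (auto intro: is_cover_branches)

lemma (in median_algebra) topspace_median_topology: "topspace (median_topology X m) = X"
  unfolding median_topology_def
proof (rule topspace_uniform_topology)
  show "median_uniformity X m \<noteq> {}"
    by (simp add: median_uniformity_def uniformity_generated_nonempty)
  show "is_cover X C" if "C \<in> median_uniformity X m" for C
    using that by (simp add: median_uniformity_def uniformity_generated_def)
qed (rule median_uniformity_directed)

lemma (in median_algebra) topspace_completion_topology:
  "topspace (completion_topology X (median_uniformity X m)) = hausdorff_completion X (median_uniformity X m)"
  unfolding completion_topology_def
proof (rule topspace_uniform_topology)
  show "completion_uniformity X (median_uniformity X m) \<noteq> {}"
    by (intro completion_uniformity_nonempty)
      (simp add: median_uniformity_def uniformity_generated_nonempty)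
  show "is_cover (hausdorff_completion X (median_uniformity X m)) D"
    if "D \<in> completion_uniformity X (median_uniformity X m)" for D
    using that by (simp add: completion_uniformity_def)
qed (rule completion_uniformity_directed[OF median_uniformity_directed])

end

theory Submission
  imports Defs
begin

text \<open>The position of a point \<open>x\<close> on a chain interval \<open>[u, v]\<close> is \<open>m u x v\<close>. The two branches of
  the interval consist of the points whose position is not \<open>v\<close>, and of those whose position is not
  \<open>u\<close>; they overlap in the points whose position is strictly inside. Two properties of
  these pairs carry the whole proof.

  \<^item> \<^emph>\<open>Normality.\<close> If \<open>(A, B)\<close> is the pair of branches of \<open>[u, v]\<close>, then there are disjoint \<open>C\<close> and
    \<open>D\<close> such that \<open>(C, B)\<close> and \<open>(A, D)\<close> are again pairs of branches (\<open>branch_normal\<close>): cut the chain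
    at an interior point, and if there is none, then \<open>A\<close> and \<open>B\<close> are themselves disjoint.

  \<^item> \<^emph>\<open>Convexity.\<close> If two of three points lie in a branch, so does their median
    (\<open>branch_median\<close>). The position of the median of \<open>x\<close>, \<open>y\<close>, \<open>z\<close> lies between those of
    \<open>x\<close> and \<open>y\<close>; in a chain it is therefore different from the endpoint \<open>v\<close> if these two are.

  Normality alone makes the completion compact Hausdorff. A filter is Cauchy iff it contains a
  member of each pair. The coarsest Cauchy filter contained in a Cauchy filter \<open>F\<close> is generated by the
  sets \<open>A\<close> for which some pair \<open>(A, B)\<close> has \<open>B \<notin> F\<close>; it is Cauchy by normality, and these
  filters are the points of the completion. Every ultrafilter is Cauchy, whence compactness, and
  two distinct points are separated by the disjoint sets that normality inserts between a pair.
  Normality also gives a simple criterion for the continuity of a map into the completion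
  (\<open>continuous_map_regular_filter\<close>), on which both extension results rest.
  The \<open>T2\<close> condition says that the pairs separate the points of \<open>X\<close>, so that \<open>X\<close> embeds.

  The median extends by a vote: each of three Cauchy filters contains a member of the pair
  \<open>(A, B)\<close>, so two of them contain the same one, and by convexity the image of their product under the
  median contains it too. The axioms of a median algebra are identities, so they pass from the dense
  image of \<open>X\<close> to the completion.

  For minimality, let \<open>\<eta>\<close> embed \<open>X\<close> in a compact median algebra \<open>K\<close> with median \<open>n\<close>. The points
  \<open>k\<close> of \<open>K\<close> with \<open>n (\<eta> u) k (\<eta> v) \<noteq> \<eta> v\<close>, and those with \<open>n (\<eta> u) k (\<eta> v) \<noteq> \<eta> u\<close>, form two open sets. They
  cover \<open>K\<close> because \<open>\<eta> u \<noteq> \<eta> v\<close>, and they pull back to the two branches of \<open>[u, v]\<close>.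
  Hence the neighbourhoods of each point of \<open>K\<close> trace a Cauchy filter on \<open>X\<close>, and this defines the
  map to the completion. It is onto because its image is compact and dense; it is a
  homomorphism, and unique, because \<open>X\<close> is dense in \<open>K\<close>.\<close>


section \<open>Ultrafilters\<close>

text \<open>Zorn's lemma, applied to the proper filters finer than \<open>F\<close>: a chain of them is bounded by its
  infimum, which is proper because its sets are those of the members of the chain.\<close>

lemma finer_ultrafilter_exists:
  fixes F :: "'a filter"
  assumes "F \<noteq> bot"
  obtains W where "W \<le> F" "W \<noteq> bot" "\<And>P. eventually P W \<or> eventually (\<lambda>x. \<not> P x) W"
proof -
  define \<A> where "\<A> = {G. G \<noteq> bot \<and> G \<le> F}"
  have "\<exists>W\<in>\<A>. \<forall>G\<in>\<A>. G \<le> W \<longrightarrow> W = G"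
  proof -
    have "\<exists>W\<in>\<A>. \<forall>G\<in>\<A>. W \<ge> G \<longrightarrow> G = W"
    proof (rule predicate_Zorn)
      show "partial_order_on \<A> (relation_of (\<ge>) \<A>)"
        by (auto simp: partial_order_on_def preorder_on_def refl_on_def trans_def antisym_def
            relation_of_def)
      show "\<exists>u\<in>\<A>. \<forall>a\<in>\<C>. u \<le> a" if \<C>: "\<C> \<in> Chains (relation_of (\<ge>) \<A>)" for \<C>
      proof (cases "\<C> = {}")
        case True
        then show ?thesis using assms by (auto simp: \<A>_def)
      next
        case False
        have sub: "\<C> \<subseteq> \<A>" and lin: "\<And>G H. \<lbrakk>G \<in> \<C>; H \<in> \<C>\<rbrakk> \<Longrightarrow> G \<le> H \<or> H \<le> G"
          using \<C> unfolding Chains_def relation_of_def by auto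
        have ev: "eventually P (Inf \<C>) \<longleftrightarrow> (\<exists>G\<in>\<C>. eventually P G)" for P
        proof (rule eventually_Inf_base[OF False])
          fix G H assume "G \<in> \<C>" "H \<in> \<C>"
          then show "\<exists>x\<in>\<C>. x \<le> inf G H"
            using lin[of G H] by auto
        qed
        have "Inf \<C> \<noteq> bot"
          using sub by (auto simp: trivial_limit_def ev \<A>_def)
        moreover have "Inf \<C> \<le> F"
          using False sub by (auto simp: \<A>_def intro: Inf_lower2)
        ultimately show ?thesis
          by (auto simp: \<A>_def intro: Inf_lower)
      qed
    qed
    then show ?thesis by auto
  qed
  then obtain W where W: "W \<noteq> bot" "W \<le> F" and max: "\<And>G. \<lbrakk>G \<noteq> bot; G \<le> W\<rbrakk> \<Longrightarrow> G = W"
    unfolding \<A>_def by (metis (mono_tags, lifting) mem_Collect_eq order_trans)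
  have "eventually P W \<or> eventually (\<lambda>x. \<not> P x) W" for P
  proof (cases "inf W (principal {x. P x}) = bot")
    case True
    then show ?thesis by (simp add: trivial_limit_def eventually_inf_principal)
  next
    case False
    then have "inf W (principal {x. P x}) = W"
      by (rule max) simp
    then have "eventually P W \<longleftrightarrow> eventually P (inf W (principal {x. P x}))" by simp
    then show ?thesis by (simp add: eventually_inf_principal)
  qed
  then show thesis using W that by blast
qed


section \<open>Uniformities generated by a normal family of two-member covers\<close>

text \<open>Read \<open>(A, B)\<close> as saying that the complements of \<open>A\<close> and \<open>B\<close> are far from each other. The last
  axiom is then the normality axiom of a proximity. In terms of covers, the star of a point in the wedge of
  \<open>{C, B}\<close> and \<open>{A, D}\<close> lies in \<open>A\<close> or in \<open>B\<close>, which is why the finite wedges of pairs generate a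
  uniformity.\<close>

locale normal_pairs =
  fixes X :: "'a set" and R :: "('a set \<times> 'a set) set"
  assumes pair_cover: "(A, B) \<in> R \<Longrightarrow> A \<union> B = X"
    and pair_sym: "(A, B) \<in> R \<Longrightarrow> (B, A) \<in> R"
    and pair_normal: "(A, B) \<in> R \<Longrightarrow> \<exists>C D. (C, B) \<in> R \<and> (A, D) \<in> R \<and> C \<inter> D = {}"
begin

definition pair_covers :: "'a set set set"
  where "pair_covers = {{A, B} | A B. (A, B) \<in> R}"

abbreviation pair_uniformity :: "'a set set set"
  where "pair_uniformity \<equiv> uniformity_generated X pair_covers"

abbreviation cauchy :: "'a filter \<Rightarrow> bool"
  where "cauchy \<equiv> uniform_cauchy_filter X pair_uniformity"

abbreviation completion :: "'a filter set"
  where "completion \<equiv> hausdorff_completion X pair_uniformity"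

abbreviation extent :: "'a set \<Rightarrow> 'a filter set"
  where "extent \<equiv> completion_set X pair_uniformity"

text \<open>If \<open>B \<notin> F\<close> for a pair \<open>(A, B)\<close>, then every Cauchy filter coarser than \<open>F\<close> omits \<open>B\<close> as
  well and so contains \<open>A\<close>. The generators below are therefore forced on any Cauchy filter
  coarser than \<open>F\<close>. For a principal filter this is the neighbourhood filter of the point.\<close>

definition regular_filter :: "'a filter \<Rightarrow> 'a filter"
  where "regular_filter F =
    inf (INF A\<in>{A. \<exists>B. (A, B) \<in> R \<and> \<not> (\<forall>\<^sub>F x in F. x \<in> B)}. principal A) (principal X)"

lemma pair_covers_are_covers: "C \<in> pair_covers \<Longrightarrow> is_cover X C"
proof -
  assume "C \<in> pair_covers"
  then obtain A B where "C = {A, B}" "(A, B) \<in> R" by (auto simp: pair_covers_def)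
  then show ?thesis using pair_cover[of A B] by (auto simp: is_cover_def)
qed

lemma wedge_in_uniformity:
  "finite \<F> \<Longrightarrow> \<F> \<subseteq> pair_covers \<Longrightarrow> cover_wedge X \<F> \<in> pair_uniformity"
  unfolding uniformity_generated_def
  using is_cover_wedge[OF pair_covers_are_covers, of \<F>]
  by (intro CollectI conjI exI[of _ \<F>]) (auto simp: cover_refines_def)

lemma uniformity_directed:
  "\<lbrakk>C \<in> pair_uniformity; D \<in> pair_uniformity\<rbrakk>
    \<Longrightarrow> \<exists>E\<in>pair_uniformity. cover_refines E C \<and> cover_refines E D"
  by (rule uniformity_generated_directed) (auto intro: pair_covers_are_covers)

text \<open>The uniformity is generated by finite wedges of pairs, and a filter that contains a member of
  each of finitely many covers contains the intersection of these members.\<close>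

lemma cauchy_iff:
  "cauchy F \<longleftrightarrow> F \<noteq> bot \<and> (\<forall>\<^sub>F x in F. x \<in> X) \<and>
    (\<forall>A B. (A, B) \<in> R \<longrightarrow> (\<forall>\<^sub>F x in F. x \<in> A) \<or> (\<forall>\<^sub>F x in F. x \<in> B))"
    (is "_ \<longleftrightarrow> ?bot \<and> ?X \<and> ?R")
proof
  assume F: "cauchy F"
  have ?R
  proof (intro allI impI)
    fix A B assume AB: "(A, B) \<in> R"
    then have C: "{A, B} \<in> pair_covers" by (auto simp: pair_covers_def)
    moreover have "cover_refines (cover_wedge X {{A, B}}) {A, B}"
      by (auto simp: cover_refines_def cover_wedge_def)
    ultimately have "{A, B} \<in> pair_uniformity"
      unfolding uniformity_generated_def using pair_covers_are_covers[OF C]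
      by (intro CollectI conjI exI[of _ "{{A, B}}"]) auto
    then have "\<exists>E\<in>{A, B}. \<forall>\<^sub>F x in F. x \<in> E"
      using F unfolding uniform_cauchy_filter_def by metis
    then show "(\<forall>\<^sub>F x in F. x \<in> A) \<or> (\<forall>\<^sub>F x in F. x \<in> B)" by simp
  qed
  then show "?bot \<and> ?X \<and> ?R"
    using F by (simp add: uniform_cauchy_filter_def)
next
  assume F: "?bot \<and> ?X \<and> ?R"
  have "\<exists>A\<in>C. \<forall>\<^sub>F x in F. x \<in> A" if "C \<in> pair_uniformity" for C
  proof -
    obtain \<F> where \<F>: "finite \<F>" "\<F> \<subseteq> pair_covers" "cover_refines (cover_wedge X \<F>) C"
      using \<open>C \<in> pair_uniformity\<close> by (auto simp: uniformity_generated_def)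
    have "\<forall>D\<in>\<F>. \<exists>A. A \<in> D \<and> (\<forall>\<^sub>F x in F. x \<in> A)"
    proof
      fix D assume "D \<in> \<F>"
      then obtain A B where D: "D = {A, B}" and "(A, B) \<in> R"
        using \<F>(2) by (auto simp: pair_covers_def)
      then have "(\<forall>\<^sub>F x in F. x \<in> A) \<or> (\<forall>\<^sub>F x in F. x \<in> B)" using F by blast
      then show "\<exists>A. A \<in> D \<and> (\<forall>\<^sub>F x in F. x \<in> A)" unfolding D by blast
    qed
    then obtain s where s: "\<forall>D\<in>\<F>. s D \<in> D \<and> (\<forall>\<^sub>F x in F. x \<in> s D)"
      by (rule bchoice[THEN exE])
    then have "X \<inter> (\<Inter>D\<in>\<F>. s D) \<in> cover_wedge X \<F>"
      unfolding cover_wedge_def by blast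
    then obtain A where A: "A \<in> C" "X \<inter> (\<Inter>D\<in>\<F>. s D) \<subseteq> A"
      using \<F>(3) unfolding cover_refines_def by blast
    have "\<forall>\<^sub>F x in F. \<forall>D\<in>\<F>. x \<in> s D"
      using s \<F>(1) by (simp add: eventually_ball_finite)
    moreover have "\<forall>\<^sub>F x in F. x \<in> X" using F by simp
    ultimately have "\<forall>\<^sub>F x in F. x \<in> A"
      by eventually_elim (use A(2) in auto)
    then show ?thesis using A(1) by blast
  qed
  then show "cauchy F"
    using F by (simp add: uniform_cauchy_filter_def)
qed

lemma cauchyD: "\<lbrakk>cauchy F; (A, B) \<in> R; \<not> (\<forall>\<^sub>F x in F. x \<in> B)\<rbrakk> \<Longrightarrow> \<forall>\<^sub>F x in F. x \<in> A"
  unfolding cauchy_iff by blast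

lemma cauchy_not_bot: "cauchy F \<Longrightarrow> F \<noteq> bot"
  by (simp add: cauchy_iff)

lemma cauchy_disjoint:
  assumes "cauchy F" "\<forall>\<^sub>F x in F. x \<in> C" "C \<inter> D = {}"
  shows "\<not> (\<forall>\<^sub>F x in F. x \<in> D)"
proof
  assume "\<forall>\<^sub>F x in F. x \<in> D"
  with assms(2) have "\<forall>\<^sub>F x in F. False"
    by eventually_elim (use assms(3) in blast)
  then show False
    using cauchy_not_bot[OF assms(1)] by (simp add: trivial_limit_def)
qed

lemma cauchy_principal: "x \<in> X \<Longrightarrow> cauchy (principal {x})"
  using pair_cover by (auto simp: cauchy_iff eventually_principal principal_eq_bot_iff)

lemma eventually_regular_filter:
  "eventually P (regular_filter F) \<longleftrightarrow>
    (\<exists>\<A>. finite \<A> \<and> (\<forall>A\<in>\<A>. \<exists>B. (A, B) \<in> R \<and> \<not> (\<forall>\<^sub>F x in F. x \<in> B)) \<and> (\<forall>x\<in>X. x \<in> \<Inter>\<A> \<longrightarrow> P x))"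
    (is "?l \<longleftrightarrow> ?r")
proof -
  let ?S = "{A. \<exists>B. (A, B) \<in> R \<and> \<not> (\<forall>\<^sub>F x in F. x \<in> B)}"
  have principal: "(INF A\<in>\<A>. principal A) = principal (\<Inter>\<A>)" if "finite \<A>" for \<A> :: "'a set set"
    using INF_principal_finite[OF that, of "\<lambda>A. A"] by simp
  have "?l \<longleftrightarrow> (\<exists>\<A>\<subseteq>?S. finite \<A> \<and> (\<forall>\<^sub>F x in (INF A\<in>\<A>. principal A). x \<in> X \<longrightarrow> P x))"
    unfolding regular_filter_def eventually_inf_principal by (rule eventually_INF)
  also have "\<dots> \<longleftrightarrow> (\<exists>\<A>\<subseteq>?S. finite \<A> \<and> (\<forall>x\<in>\<Inter>\<A>. x \<in> X \<longrightarrow> P x))"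
    by (simp add: principal eventually_principal cong: conj_cong)
  also have "\<dots> \<longleftrightarrow> ?r"
    by (intro iff_exI) (auto simp: subset_eq)
  finally show ?thesis .
qed

lemma regular_filter_carrier: "\<forall>\<^sub>F x in regular_filter F. x \<in> X"
  unfolding eventually_regular_filter by (intro exI[of _ "{}"]) simp

lemma regular_filterI:
  "\<lbrakk>(A, B) \<in> R; \<not> (\<forall>\<^sub>F x in F. x \<in> B)\<rbrakk> \<Longrightarrow> \<forall>\<^sub>F x in regular_filter F. x \<in> A"
  unfolding eventually_regular_filter by (intro exI[of _ "{A}"]) auto

text \<open>Coarsening a filter only removes sets, so a generator of \<open>regular_filter F\<close> remains forced on
  every coarser Cauchy filter \<open>G\<close>.\<close>

lemma le_regular_filter:
  assumes "cauchy F" "cauchy G" "F \<le> G"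
  shows "G \<le> regular_filter F"
proof (rule filter_leI)
  fix P assume "eventually P (regular_filter F)"
  then obtain \<A> where \<A>: "finite \<A>" "\<forall>A\<in>\<A>. \<exists>B. (A, B) \<in> R \<and> \<not> (\<forall>\<^sub>F x in F. x \<in> B)"
    "\<forall>x\<in>X. x \<in> \<Inter>\<A> \<longrightarrow> P x"
    unfolding eventually_regular_filter by blast
  have "\<forall>A\<in>\<A>. \<forall>\<^sub>F x in G. x \<in> A"
    using \<A>(2) assms(3) cauchyD[OF assms(2)] by (meson filter_leD)
  then have "\<forall>\<^sub>F x in G. \<forall>A\<in>\<A>. x \<in> A"
    using \<A>(1) by (simp add: eventually_ball_finite)
  moreover have "\<forall>\<^sub>F x in G. x \<in> X"
    using assms(2) by (simp add: cauchy_iff)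
  ultimately show "eventually P G"
    by eventually_elim (use \<A>(3) in auto)
qed

text \<open>This is where normality enters. A proper filter cannot contain both of the disjoint sets \<open>C\<close> and \<open>D\<close>
  inserted between \<open>A\<close> and \<open>B\<close>; if it omits \<open>D\<close>, then \<open>(A, D)\<close> forces \<open>A\<close>, and if it omits \<open>C\<close>, then
  \<open>(C, B)\<close> forces \<open>B\<close>.\<close>

lemma cauchy_regular_filter:
  assumes "cauchy F" shows "cauchy (regular_filter F)"
  unfolding cauchy_iff
proof (intro conjI allI impI)
  have "F \<le> regular_filter F"
    by (rule le_regular_filter) (use assms in auto)
  then show "regular_filter F \<noteq> bot"
    using cauchy_not_bot[OF assms] by (auto simp: bot_unique)
  show "\<forall>\<^sub>F x in regular_filter F. x \<in> X"
    by (rule regular_filter_carrier)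
  fix A B assume "(A, B) \<in> R"
  then obtain C D where CD: "(C, B) \<in> R" "(A, D) \<in> R" "C \<inter> D = {}"
    using pair_normal by blast
  then consider "\<not> (\<forall>\<^sub>F x in F. x \<in> C)" | "\<not> (\<forall>\<^sub>F x in F. x \<in> D)"
    using cauchy_disjoint[OF assms] by blast
  then show "(\<forall>\<^sub>F x in regular_filter F. x \<in> A) \<or> (\<forall>\<^sub>F x in regular_filter F. x \<in> B)"
    using CD regular_filterI pair_sym by cases blast+
qed

lemma eventually_regular_filter_point:
  assumes "x \<in> X" "eventually P (regular_filter (principal {x}))"
  shows "P x"
proof -
  have "eventually P (principal {x})"
    using le_regular_filter[OF cauchy_principal[OF assms(1)] cauchy_principal[OF assms(1)] order_refl]
      assms(2) by (rule filter_leD)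
  then show ?thesis by (simp add: eventually_principal)
qed

lemma regular_filter_cong:
  assumes "cauchy F" "cauchy G" "F \<le> G"
  shows "regular_filter F = regular_filter G"
proof (rule antisym)
  have "F \<le> regular_filter G"
    using assms le_regular_filter[OF assms(2,2)] by simp
  then have "regular_filter G \<le> regular_filter F"
    using le_regular_filter[OF assms(1) cauchy_regular_filter[OF assms(2)]] by simp
  then show "regular_filter G \<le> regular_filter F" .
  have "G \<le> regular_filter F"
    using le_regular_filter[OF assms] .
  then show "regular_filter F \<le> regular_filter G"
    using le_regular_filter[OF assms(2) cauchy_regular_filter[OF assms(1)]] by simp
qed

lemma completion_iff: "F \<in> completion \<longleftrightarrow> cauchy F \<and> regular_filter F = F"
proof
  assume F: "F \<in> completion"
  then have "cauchy F" by (simp add: hausdorff_completion_def)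
  moreover have "regular_filter F = F"
    using F cauchy_regular_filter[of F] le_regular_filter[of F F]
    by (simp add: hausdorff_completion_def)
  ultimately show "cauchy F \<and> regular_filter F = F" by simp
next
  assume F: "cauchy F \<and> regular_filter F = F"
  then have "G = F" if "cauchy G" "F \<le> G" for G
    using le_regular_filter[of F G] that by simp
  then show "F \<in> completion"
    using F by (simp add: hausdorff_completion_def)
qed

lemma regular_filter_in_completion: "cauchy F \<Longrightarrow> regular_filter F \<in> completion"
  using regular_filter_cong[of F "regular_filter F"] le_regular_filter[of F F]
  by (simp add: completion_iff cauchy_regular_filter)

lemma extent_iff: "F \<in> extent A \<longleftrightarrow> F \<in> completion \<and> (\<forall>\<^sub>F x in F. x \<in> A)"
  by (simp add: completion_set_def)

text \<open>The analogue of the fact that the interior of a neighbourhood is a neighbourhood. If \<open>B\<close> is omitted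
  by \<open>F\<close> and \<open>C\<close>, \<open>D\<close> are inserted between \<open>A\<close> and \<open>B\<close>, then \<open>C\<close> is forced, and every point of \<open>C\<close> lies
  outside \<open>D\<close>, which makes \<open>A\<close> a neighbourhood of that point.\<close>

lemma regular_filter_interior:
  assumes "cauchy F" "\<forall>\<^sub>F x in regular_filter F. x \<in> S"
  shows "\<forall>\<^sub>F x in regular_filter F. x \<in> X \<and> (\<forall>\<^sub>F y in regular_filter (principal {x}). y \<in> S)"
proof -
  obtain \<A> where \<A>: "finite \<A>" "\<forall>A\<in>\<A>. \<exists>B. (A, B) \<in> R \<and> \<not> (\<forall>\<^sub>F x in F. x \<in> B)"
    "\<forall>x\<in>X. x \<in> \<Inter>\<A> \<longrightarrow> x \<in> S"
    using assms(2) unfolding eventually_regular_filter by blast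
  have "\<forall>\<^sub>F x in regular_filter F. \<exists>D. (A, D) \<in> R \<and> x \<notin> D" if "A \<in> \<A>" for A
  proof -
    obtain B where B: "(A, B) \<in> R" "\<not> (\<forall>\<^sub>F x in F. x \<in> B)"
      using \<A>(2) \<open>A \<in> \<A>\<close> by blast
    then obtain C D where CD: "(C, B) \<in> R" "(A, D) \<in> R" "C \<inter> D = {}"
      using pair_normal by blast
    have "\<forall>\<^sub>F x in regular_filter F. x \<in> C"
      by (rule regular_filterI[OF CD(1) B(2)])
    then show ?thesis
      by (rule eventually_mono) (use CD in blast)
  qed
  then have "\<forall>\<^sub>F x in regular_filter F. \<forall>A\<in>\<A>. \<exists>D. (A, D) \<in> R \<and> x \<notin> D"
    using \<A>(1) by (simp add: eventually_ball_finite)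
  then show ?thesis
    using regular_filter_carrier
  proof eventually_elim
    case (elim x)
    then have "\<forall>\<^sub>F y in regular_filter (principal {x}). y \<in> S"
      unfolding eventually_regular_filter eventually_principal
      using \<A>(1,3) by (intro exI[of _ \<A>]) auto
    then show ?case using elim by blast
  qed
qed


section \<open>The topologies of the space and of its completion\<close>

text \<open>The star of \<open>x\<close> in a pair \<open>(A, B)\<close> is \<open>A\<close> if \<open>x \<notin> B\<close>, is \<open>B\<close> if \<open>x \<notin> A\<close>, and is everything otherwise. So
  the stars of \<open>x\<close> and the finite intersections of generators of the regular filter at \<open>x\<close> are cofinal.\<close>

lemma star_sub_iff_regular_filter:
  assumes "x \<in> X"
  shows "(\<exists>C\<in>pair_uniformity. cover_star C x \<subseteq> G) \<longleftrightarrow>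
    (\<forall>\<^sub>F y in regular_filter (principal {x}). y \<in> G)"
proof
  assume "\<exists>C\<in>pair_uniformity. cover_star C x \<subseteq> G"
  then obtain C where C: "C \<in> pair_uniformity" "cover_star C x \<subseteq> G" by blast
  obtain \<F> where \<F>: "finite \<F>" "\<F> \<subseteq> pair_covers" "cover_refines (cover_wedge X \<F>) C"
    using C(1) by (auto simp: uniformity_generated_def)
  \<comment> \<open>Two points lie in a common wedge member iff each of the covers has a member containing both.\<close>
  define near where "near = (\<lambda>y D. \<exists>A\<in>D. x \<in> A \<and> y \<in> A)"
  have "\<forall>\<^sub>F y in regular_filter (principal {x}). near y D" if "D \<in> \<F>" for D
  proof -
    obtain A B where D: "D = {A, B}" and AB: "(A, B) \<in> R"
      using \<F>(2) \<open>D \<in> \<F>\<close> by (auto simp: pair_covers_def)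
    have cover: "A \<union> B = X" using pair_cover[OF AB] .
    consider "x \<notin> B" | "x \<notin> A" | "x \<in> A" "x \<in> B" by blast
    then show ?thesis
    proof cases
      case 1
      then have "\<forall>\<^sub>F y in regular_filter (principal {x}). y \<in> A"
        by (intro regular_filterI[OF AB]) (simp add: eventually_principal)
      then show ?thesis
        by (rule eventually_mono) (use 1 cover assms in \<open>auto simp: near_def D\<close>)
    next
      case 2
      then have "\<forall>\<^sub>F y in regular_filter (principal {x}). y \<in> B"
        by (intro regular_filterI[OF pair_sym[OF AB]]) (simp add: eventually_principal)
      then show ?thesis
        by (rule eventually_mono) (use 2 cover assms in \<open>auto simp: near_def D\<close>)
    next
      case 3
      show ?thesis
        using regular_filter_carrier
        by (rule eventually_mono) (use 3 cover in \<open>auto simp: near_def D\<close>)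
    qed
  qed
  then have "\<forall>\<^sub>F y in regular_filter (principal {x}). \<forall>D\<in>\<F>. near y D"
    using \<F>(1) by (simp add: eventually_ball_finite)
  then show "\<forall>\<^sub>F y in regular_filter (principal {x}). y \<in> G"
    using regular_filter_carrier
  proof eventually_elim
    case (elim y)
    then obtain s where s: "\<forall>D\<in>\<F>. s D \<in> D \<and> x \<in> s D \<and> y \<in> s D"
      unfolding near_def by metis
    then have "X \<inter> (\<Inter>D\<in>\<F>. s D) \<in> cover_wedge X \<F>"
      unfolding cover_wedge_def by blast
    then obtain A where "A \<in> C" "X \<inter> (\<Inter>D\<in>\<F>. s D) \<subseteq> A"
      using \<F>(3) unfolding cover_refines_def by blast
    then have "y \<in> cover_star C x"
      using s elim assms unfolding cover_star_def by blast
    then show ?case using C(2) by blast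
  qed
next
  assume "\<forall>\<^sub>F y in regular_filter (principal {x}). y \<in> G"
  then obtain \<A> where \<A>: "finite \<A>" "\<forall>A\<in>\<A>. \<exists>B. (A, B) \<in> R \<and> x \<notin> B"
    "\<forall>y\<in>X. y \<in> \<Inter>\<A> \<longrightarrow> y \<in> G"
    unfolding eventually_regular_filter eventually_principal by auto
  then obtain b where b: "\<forall>A\<in>\<A>. (A, b A) \<in> R \<and> x \<notin> b A"
    by metis
  define \<F> where "\<F> = (\<lambda>A. {A, b A}) ` \<A>"
  have "cover_wedge X \<F> \<in> pair_uniformity"
    by (rule wedge_in_uniformity) (use \<A>(1) b in \<open>auto simp: \<F>_def pair_covers_def\<close>)
  moreover have "cover_star (cover_wedge X \<F>) x \<subseteq> G"
  proof
    fix y assume "y \<in> cover_star (cover_wedge X \<F>) x"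
    then obtain s where s: "\<forall>D\<in>\<F>. s D \<in> D" and xy: "x \<in> X \<inter> (\<Inter>D\<in>\<F>. s D)" "y \<in> X \<inter> (\<Inter>D\<in>\<F>. s D)"
      unfolding cover_star_def cover_wedge_def by blast
    have "y \<in> A" if "A \<in> \<A>" for A
    proof -
      have D: "{A, b A} \<in> \<F>" using that by (simp add: \<F>_def)
      have "s {A, b A} \<in> {A, b A}" using s D by (rule bspec)
      moreover have "x \<in> s {A, b A}" "y \<in> s {A, b A}"
        using INT_D[OF IntD2[OF xy(1)] D] INT_D[OF IntD2[OF xy(2)] D] .
      moreover have "x \<notin> b A" using bspec[OF b that] by simp
      ultimately show ?thesis by auto
    qed
    then show "y \<in> G" using \<A>(3) xy(2) by blast
  qed
  ultimately show "\<exists>C\<in>pair_uniformity. cover_star C x \<subseteq> G" by blast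
qed

lemma openin_pair_topology:
  "openin (uniform_topology X pair_uniformity) G \<longleftrightarrow>
    G \<subseteq> X \<and> (\<forall>x\<in>G. \<forall>\<^sub>F y in regular_filter (principal {x}). y \<in> G)"
proof -
  have "openin (uniform_topology X pair_uniformity) G \<longleftrightarrow>
      G \<subseteq> X \<and> (\<forall>x\<in>G. \<exists>C\<in>pair_uniformity. cover_star C x \<subseteq> G)"
    by (rule openin_uniform_topology[OF uniformity_generated_nonempty uniformity_directed])
  then show ?thesis
    using star_sub_iff_regular_filter by (metis subsetD)
qed

lemma topspace_pair_topology: "topspace (uniform_topology X pair_uniformity) = X"
  by (rule topspace_uniform_topology[OF uniformity_generated_nonempty _ uniformity_directed])
    (auto simp: uniformity_generated_def)

lemma completion_map_eq_regular_filter: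
  assumes "x \<in> X"
  shows "completion_map X pair_uniformity x = regular_filter (principal {x})"
  unfolding filter_eq_iff completion_map_def eventually_nhdsin topspace_pair_topology
proof (intro allI iffI)
  fix P
  assume "x \<notin> X \<or> (\<exists>S. openin (uniform_topology X pair_uniformity) S \<and> x \<in> S \<and> (\<forall>x\<in>S. P x))"
  then obtain S where S: "openin (uniform_topology X pair_uniformity) S" "x \<in> S" "\<forall>x\<in>S. P x"
    using assms by blast
  then have "\<forall>\<^sub>F y in regular_filter (principal {x}). y \<in> S"
    by (simp add: openin_pair_topology)
  then show "eventually P (regular_filter (principal {x}))"
    by (rule eventually_mono) (use S(3) in blast)
next
  fix P assume P: "eventually P (regular_filter (principal {x}))"
  define S where "S = {y \<in> X. eventually P (regular_filter (principal {y}))}"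
  have "\<forall>\<^sub>F z in regular_filter (principal {y}). z \<in> S" if "y \<in> S" for y
    using regular_filter_interior[of "principal {y}" "Collect P"] that cauchy_principal
    by (simp add: S_def)
  then have "openin (uniform_topology X pair_uniformity) S"
    by (auto simp: openin_pair_topology S_def)
  moreover have "x \<in> S" using P assms by (simp add: S_def)
  moreover have "P y" if "y \<in> S" for y
    using that eventually_regular_filter_point[of y P] by (simp add: S_def)
  ultimately show "x \<notin> X \<or>
      (\<exists>S. openin (uniform_topology X pair_uniformity) S \<and> x \<in> S \<and> (\<forall>x\<in>S. P x))"
    by blast
qed

abbreviation completion_space :: "'a filter topology"
  where "completion_space \<equiv> completion_topology X pair_uniformity"

abbreviation embed :: "'a \<Rightarrow> 'a filter"
  where "embed \<equiv> completion_map X pair_uniformity"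

lemma topspace_completion_space: "topspace completion_space = completion"
  unfolding completion_topology_def
  by (rule topspace_uniform_topology[OF completion_uniformity_nonempty[OF uniformity_generated_nonempty] _
        completion_uniformity_directed[OF uniformity_directed]])
    (auto simp: completion_uniformity_def)

text \<open>The sets \<open>extent A\<close> form a base. One direction is the Cauchy property. For the other,
  if \<open>A \<in> F\<close> then \<open>A\<close> contains a finite intersection of generators; a member of the
  corresponding wedge that belongs to \<open>F\<close> can only be this intersection, because the other choices
  involve some \<open>B \<notin> F\<close>.\<close>

lemma openin_completion_space:
  "openin completion_space \<G> \<longleftrightarrow>
    \<G> \<subseteq> completion \<and> (\<forall>F\<in>\<G>. \<exists>A. (\<forall>\<^sub>F x in F. x \<in> A) \<and> extent A \<subseteq> \<G>)"
proof -
  have "(\<exists>D\<in>completion_uniformity X pair_uniformity. cover_star D F \<subseteq> \<G>) \<longleftrightarrow>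
      (\<exists>A. (\<forall>\<^sub>F x in F. x \<in> A) \<and> extent A \<subseteq> \<G>)" (is "?l \<longleftrightarrow> ?r")
    if F: "F \<in> completion" for F
  proof
    assume ?l
    then obtain D C where DC: "cover_star D F \<subseteq> \<G>" "C \<in> pair_uniformity" "cover_refines (extent ` C) D"
      by (auto simp: completion_uniformity_def)
    obtain A where A: "A \<in> C" "\<forall>\<^sub>F x in F. x \<in> A"
      using F DC(2) by (auto simp: completion_iff uniform_cauchy_filter_def)
    then obtain E where E: "E \<in> D" "extent A \<subseteq> E"
      using DC(3) by (auto simp: cover_refines_def)
    have "F \<in> E" using E A F by (auto simp: extent_iff)
    then have "extent A \<subseteq> \<G>"
      using E DC(1) unfolding cover_star_def by blast
    then show ?r using A by blast
  next
    assume ?r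
    then obtain S where S: "\<forall>\<^sub>F x in F. x \<in> S" "extent S \<subseteq> \<G>" by blast
    have "\<forall>\<^sub>F x in regular_filter F. x \<in> S"
      using S F by (simp add: completion_iff)
    then obtain \<A> where \<A>: "finite \<A>" "\<forall>A\<in>\<A>. \<exists>B. (A, B) \<in> R \<and> \<not> (\<forall>\<^sub>F x in F. x \<in> B)"
      "\<forall>y\<in>X. y \<in> \<Inter>\<A> \<longrightarrow> y \<in> S"
      unfolding eventually_regular_filter by auto
    then obtain b where b: "\<forall>A\<in>\<A>. (A, b A) \<in> R \<and> \<not> (\<forall>\<^sub>F x in F. x \<in> b A)"
      by metis
    define \<F> where "\<F> = (\<lambda>A. {A, b A}) ` \<A>"
    have W: "cover_wedge X \<F> \<in> pair_uniformity"
      by (rule wedge_in_uniformity) (use \<A>(1) b in \<open>auto simp: \<F>_def pair_covers_def\<close>)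
    then have "extent ` cover_wedge X \<F> \<in> completion_uniformity X pair_uniformity"
      using is_cover_completion_set[OF W] by (auto simp: completion_uniformity_def cover_refines_def)
    moreover have "cover_star (extent ` cover_wedge X \<F>) F \<subseteq> \<G>"
    proof
      fix G assume "G \<in> cover_star (extent ` cover_wedge X \<F>) F"
      then obtain s where s: "\<forall>D\<in>\<F>. s D \<in> D"
        and FG: "F \<in> extent (X \<inter> (\<Inter>D\<in>\<F>. s D))" "G \<in> extent (X \<inter> (\<Inter>D\<in>\<F>. s D))"
        unfolding cover_star_def cover_wedge_def by blast
      have "s {A, b A} = A" if "A \<in> \<A>" for A
      proof -
        have D: "{A, b A} \<in> \<F>" using that by (simp add: \<F>_def)
        have "\<forall>\<^sub>F x in F. x \<in> s {A, b A}"
          using FG(1) D by (auto simp: extent_iff elim: eventually_mono)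
        then have "s {A, b A} \<noteq> b A" using bspec[OF b that] by auto
        moreover have "s {A, b A} \<in> {A, b A}" using s D by (rule bspec)
        ultimately show ?thesis by simp
      qed
      then have "X \<inter> (\<Inter>D\<in>\<F>. s D) \<subseteq> S"
        using \<A>(3) by (auto simp: \<F>_def)
      then have "G \<in> extent S"
        using FG(2) completion_set_mono by blast
      then show "G \<in> \<G>" using S(2) by blast
    qed
    ultimately show ?l by blast
  qed
  then have "(\<forall>F\<in>\<G>. \<exists>D\<in>completion_uniformity X pair_uniformity. cover_star D F \<subseteq> \<G>) \<longleftrightarrow>
      (\<forall>F\<in>\<G>. \<exists>A. (\<forall>\<^sub>F x in F. x \<in> A) \<and> extent A \<subseteq> \<G>)" if "\<G> \<subseteq> completion"
    using that by (intro ball_cong) auto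
  moreover have "openin completion_space \<G> \<longleftrightarrow> \<G> \<subseteq> completion \<and>
      (\<forall>F\<in>\<G>. \<exists>D\<in>completion_uniformity X pair_uniformity. cover_star D F \<subseteq> \<G>)"
    unfolding completion_topology_def
    by (rule openin_uniform_topology[OF completion_uniformity_nonempty[OF uniformity_generated_nonempty]
          completion_uniformity_directed[OF uniformity_directed]])
  ultimately show ?thesis
    by argo
qed

lemma openin_extent: "openin completion_space (extent A)"
  unfolding openin_completion_space by (intro conjI ballI exI[of _ A]) (auto simp: extent_iff)

text \<open>A filter \<open>\<Phi> z\<close> varying with \<open>z\<close> need not be regular, and \<open>A \<in> \<Phi> z'\<close> does not force
  \<open>A\<close> to belong to the regular filter. The hypothesis is therefore applied to a pair \<open>(C, B)\<close> given by
  normality: near \<open>z\<close> the set \<open>C\<close> belongs to \<open>\<Phi> z'\<close>, so the disjoint set \<open>D\<close> does not, and then the pair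
  \<open>(A, D)\<close> forces \<open>A\<close>.\<close>

lemma continuous_map_regular_filter:
  assumes cauchy: "\<And>z. z \<in> topspace Z \<Longrightarrow> cauchy (\<Phi> z)"
    and near: "\<And>A B z. \<lbrakk>(A, B) \<in> R; z \<in> topspace Z; \<not> (\<forall>\<^sub>F x in \<Phi> z. x \<in> B)\<rbrakk>
      \<Longrightarrow> \<exists>V. openin Z V \<and> z \<in> V \<and> (\<forall>z'\<in>V. \<forall>\<^sub>F x in \<Phi> z'. x \<in> A)"
  shows "continuous_map Z completion_space (\<lambda>z. regular_filter (\<Phi> z))"
  unfolding continuous_map_def topspace_completion_space
proof (intro conjI allI impI)
  show "(\<lambda>z. regular_filter (\<Phi> z)) \<in> topspace Z \<rightarrow> completion"
    using cauchy regular_filter_in_completion by blast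
  fix \<G> assume \<G>: "openin completion_space \<G>"
  show "openin Z {z \<in> topspace Z. regular_filter (\<Phi> z) \<in> \<G>}"
  proof (subst openin_subopen, intro ballI)
    fix z assume z: "z \<in> {z \<in> topspace Z. regular_filter (\<Phi> z) \<in> \<G>}"
    then obtain S where S: "\<forall>\<^sub>F x in regular_filter (\<Phi> z). x \<in> S" "extent S \<subseteq> \<G>"
      using \<G> unfolding openin_completion_space by blast
    then obtain \<A> where \<A>: "finite \<A>" "\<forall>A\<in>\<A>. \<exists>B. (A, B) \<in> R \<and> \<not> (\<forall>\<^sub>F x in \<Phi> z. x \<in> B)"
      "\<forall>y\<in>X. y \<in> \<Inter>\<A> \<longrightarrow> y \<in> S"
      unfolding eventually_regular_filter by auto
    have "\<exists>V. openin Z V \<and> z \<in> V \<and> (\<forall>z'\<in>V. \<forall>\<^sub>F x in regular_filter (\<Phi> z'). x \<in> A)"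
      if "A \<in> \<A>" for A
    proof -
      obtain B where B: "(A, B) \<in> R" "\<not> (\<forall>\<^sub>F x in \<Phi> z. x \<in> B)" using \<A>(2) \<open>A \<in> \<A>\<close> by blast
      then obtain C D where CD: "(C, B) \<in> R" "(A, D) \<in> R" "C \<inter> D = {}"
        using pair_normal by blast
      then obtain V where V: "openin Z V" "z \<in> V" "\<forall>z'\<in>V. \<forall>\<^sub>F x in \<Phi> z'. x \<in> C"
        using near[OF CD(1) _ B(2)] z by blast
      have "\<forall>\<^sub>F x in regular_filter (\<Phi> z'). x \<in> A" if "z' \<in> V" for z'
      proof (rule regular_filterI[OF CD(2)], rule cauchy_disjoint[OF cauchy _ CD(3)])
        show "z' \<in> topspace Z" using openin_subset[OF V(1)] that by blast
      qed (use V(3) that in blast)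
      then show ?thesis using V by blast
    qed
    then obtain V where V: "\<forall>A\<in>\<A>. openin Z (V A) \<and> z \<in> V A \<and>
        (\<forall>z'\<in>V A. \<forall>\<^sub>F x in regular_filter (\<Phi> z'). x \<in> A)"
      by metis
    define N where "N = topspace Z \<inter> (\<Inter>A\<in>\<A>. V A)"
    have "openin Z N"
      unfolding N_def by (rule openin_Int_Inter[unfolded INF_image]) (use \<A>(1) V in auto)
    moreover have "z \<in> N" using V z by (simp add: N_def)
    moreover have "regular_filter (\<Phi> z') \<in> \<G>" if z': "z' \<in> N" for z'
    proof -
      have "\<forall>\<^sub>F x in regular_filter (\<Phi> z'). \<forall>A\<in>\<A>. x \<in> A"
        using V z' \<A>(1) by (simp add: eventually_ball_finite N_def)
      then have "\<forall>\<^sub>F x in regular_filter (\<Phi> z'). x \<in> S"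
        using regular_filter_carrier by eventually_elim (use \<A>(3) in auto)
      then show ?thesis
        using S(2) regular_filter_in_completion[OF cauchy] z' by (auto simp: extent_iff N_def)
    qed
    ultimately show "\<exists>T. openin Z T \<and> z \<in> T \<and> T \<subseteq> {z \<in> topspace Z. regular_filter (\<Phi> z) \<in> \<G>}"
      using openin_subset by (intro exI[of _ N]) blast
  qed
qed


section \<open>Compactness and separation\<close>

text \<open>A family of closed sets with the finite intersection property lies in an ultrafilter \<open>W\<close> on the completion.
  The sets \<open>A\<close> whose extent belongs to \<open>W\<close> form a Cauchy filter \<open>G\<close> on \<open>X\<close>, and \<open>W\<close> converges to
  the regular filter of \<open>G\<close>.\<close>

lemma compact_completion_space: "compact_space completion_space"
  unfolding compact_space_fip
proof (intro allI impI, elim conjE)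
  fix \<U> assume closed: "\<forall>C\<in>\<U>. closedin completion_space C"
    and fip: "\<forall>\<F>. finite \<F> \<and> \<F> \<subseteq> \<U> \<longrightarrow> \<Inter>\<F> \<noteq> {}"
  have "(INF C\<in>\<U>. principal C) \<noteq> bot"
  proof (rule INF_filter_not_bot)
    fix \<F> assume "\<F> \<subseteq> \<U>" "finite \<F>"
    then show "(INF C\<in>\<F>. principal C) \<noteq> bot"
      using fip INF_principal_finite[of \<F> "\<lambda>C. C"] by (simp add: principal_eq_bot_iff)
  qed
  then obtain W where W: "W \<le> (INF C\<in>\<U>. principal C)" "W \<noteq> bot"
    and ultra: "\<And>P. eventually P W \<or> eventually (\<lambda>x. \<not> P x) W"
    using finer_ultrafilter_exists by blast
  have WC: "\<forall>\<^sub>F F in W. F \<in> C" if "C \<in> \<U>" for C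
    using W(1) that by (simp add: le_INF_iff le_principal)
  show "\<Inter>\<U> \<noteq> {}"
  proof (cases "\<U> = {}")
    case False
    then obtain C0 where "C0 \<in> \<U>" by blast
    then have Wc: "\<forall>\<^sub>F F in W. F \<in> completion"
      using WC[of C0] closed closedin_subset topspace_completion_space
      by (metis (mono_tags, lifting) eventually_mono subsetD)
    \<comment> \<open>The limit, in the sense that its sets are those contained in almost all points of the ultrafilter.\<close>
    define G where "G = Abs_filter (\<lambda>P. \<forall>\<^sub>F F in W. eventually P F)"
    have ev: "eventually P G \<longleftrightarrow> (\<forall>\<^sub>F F in W. eventually P F)" for P
      unfolding G_def
    proof (rule eventually_Abs_filter, rule is_filter.intro)
      show "\<forall>\<^sub>F F in W. \<forall>\<^sub>F x in F. True"
        by (rule always_eventually) simp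
      show "\<forall>\<^sub>F F in W. eventually P F \<Longrightarrow> \<forall>\<^sub>F F in W. eventually Q F \<Longrightarrow>
          \<forall>\<^sub>F F in W. \<forall>\<^sub>F x in F. P x \<and> Q x" for P Q
        by (simp add: eventually_conj_iff)
      show "\<forall>x. P x \<longrightarrow> Q x \<Longrightarrow> \<forall>\<^sub>F F in W. eventually P F \<Longrightarrow> \<forall>\<^sub>F F in W. eventually Q F" for P Q
        by (auto elim!: eventually_mono)
    qed
    have G: "cauchy G"
      unfolding cauchy_iff
    proof (intro conjI allI impI)
      show "G \<noteq> bot"
      proof
        assume "G = bot"
        then have "\<forall>\<^sub>F F in W. eventually (\<lambda>_. False) F"
          using ev[of "\<lambda>_. False"] by simp
        then have "\<forall>\<^sub>F F in W. False"
          using Wc by eventually_elim (auto simp: completion_iff cauchy_iff trivial_limit_def)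
        then show False using W(2) by (simp add: trivial_limit_def)
      qed
      show "\<forall>\<^sub>F x in G. x \<in> X"
        unfolding ev using Wc by eventually_elim (simp add: completion_iff cauchy_iff)
      fix A B assume AB: "(A, B) \<in> R"
      show "(\<forall>\<^sub>F x in G. x \<in> A) \<or> (\<forall>\<^sub>F x in G. x \<in> B)"
        unfolding ev using ultra[of "\<lambda>F. \<forall>\<^sub>F x in F. x \<in> A"]
      proof
        assume "\<forall>\<^sub>F F in W. \<not> (\<forall>\<^sub>F x in F. x \<in> A)"
        then have "\<forall>\<^sub>F F in W. \<forall>\<^sub>F x in F. x \<in> B"
          using Wc by eventually_elim (use AB in \<open>auto simp: completion_iff cauchy_iff\<close>)
        then show "(\<forall>\<^sub>F F in W. \<forall>\<^sub>F x in F. x \<in> A) \<or> (\<forall>\<^sub>F F in W. \<forall>\<^sub>F x in F. x \<in> B)" ..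
      qed blast
    qed
    have "regular_filter G \<in> C" if C: "C \<in> \<U>" for C
    proof (rule ccontr)
      assume "regular_filter G \<notin> C"
      moreover have "openin completion_space (completion - C)"
        using closed C by (simp add: closedin_def topspace_completion_space)
      ultimately obtain A where A: "\<forall>\<^sub>F x in regular_filter G. x \<in> A" "extent A \<subseteq> completion - C"
        using regular_filter_in_completion[OF G] unfolding openin_completion_space by blast
      have "\<forall>\<^sub>F x in G. x \<in> A"
        using le_regular_filter[OF G G] A(1) by (simp add: filter_leD)
      then have "\<forall>\<^sub>F F in W. \<forall>\<^sub>F x in F. x \<in> A" by (simp add: ev)
      then have "\<forall>\<^sub>F F in W. False"
        using Wc WC[OF C] by eventually_elim (use A(2) in \<open>auto simp: extent_iff\<close>)
      then show False using W(2) by (simp add: trivial_limit_def)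
    qed
    then show ?thesis by blast
  qed simp
qed

text \<open>If two points of the completion contained a common member of every pair, their intersection, which is \<open>sup\<close> in
  the order on filters, would be a coarser Cauchy filter, and both points would equal it by minimality. So
  some pair \<open>(A, B)\<close> tells them apart, and the extents of \<open>C\<close> and \<open>D\<close> separate them.\<close>

lemma Hausdorff_completion_space: "Hausdorff_space completion_space"
  unfolding Hausdorff_space_def topspace_completion_space
proof (intro allI impI, elim conjE)
  fix F G assume FG: "F \<in> completion" "G \<in> completion" "F \<noteq> G"
  have cF: "cauchy F" and cG: "cauchy G" using FG by (auto simp: completion_iff)
  have "\<exists>A B. (A, B) \<in> R \<and> \<not> (\<forall>\<^sub>F x in F. x \<in> B) \<and> \<not> (\<forall>\<^sub>F x in G. x \<in> A)"
  proof (rule ccontr)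
    assume *: "\<not> ?thesis"
    have "(\<forall>\<^sub>F x in sup F G. x \<in> A) \<or> (\<forall>\<^sub>F x in sup F G. x \<in> B)" if "(A, B) \<in> R" for A B
      using * that pair_sym[OF that] cauchyD[OF cF] cauchyD[OF cG] unfolding eventually_sup by blast
    then have "cauchy (sup F G)"
      using cF cG by (auto simp: cauchy_iff eventually_sup)
    then have "sup F G = F" "sup F G = G"
      using FG by (auto simp: hausdorff_completion_def)
    then show False using FG(3) by simp
  qed
  then obtain A B where AB: "(A, B) \<in> R" "\<not> (\<forall>\<^sub>F x in F. x \<in> B)" "\<not> (\<forall>\<^sub>F x in G. x \<in> A)" by blast
  then obtain C D where CD: "(C, B) \<in> R" "(A, D) \<in> R" "C \<inter> D = {}"
    using pair_normal by blast
  show "\<exists>U V. openin completion_space U \<and> openin completion_space V \<and> F \<in> U \<and> G \<in> V \<and> disjnt U V"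
  proof (intro exI conjI)
    show "openin completion_space (extent C)" "openin completion_space (extent D)"
      by (rule openin_extent)+
    show "F \<in> extent C"
      using FG cauchyD[OF cF CD(1) AB(2)] by (simp add: extent_iff)
    show "G \<in> extent D"
      using FG cauchyD[OF cG pair_sym[OF CD(2)] AB(3)] by (simp add: extent_iff)
    show "disjnt (extent C) (extent D)"
      using CD(3) cauchy_disjoint by (auto simp: disjnt_def extent_iff completion_iff)
  qed
qed


section \<open>The canonical map and the extension of continuous maps\<close>

lemma embed_in_completion: "x \<in> X \<Longrightarrow> embed x \<in> completion"
  by (simp add: completion_map_eq_regular_filter regular_filter_in_completion cauchy_principal)

lemma dense_embed: "completion_space closure_of (embed ` X) = topspace completion_space"
proof -
  have "\<exists>x\<in>X. embed x \<in> \<G>" if F: "F \<in> \<G>" and \<G>: "openin completion_space \<G>" for F \<G>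
  proof -
    obtain S where S: "\<forall>\<^sub>F x in F. x \<in> S" "extent S \<subseteq> \<G>" and Fc: "F \<in> completion"
      using F \<G> unfolding openin_completion_space by blast
    have "\<forall>\<^sub>F x in F. x \<in> X \<and> (\<forall>\<^sub>F y in regular_filter (principal {x}). y \<in> S)"
      using regular_filter_interior[of F S] S(1) Fc by (simp add: completion_iff)
    moreover have "F \<noteq> bot" using Fc by (simp add: completion_iff cauchy_iff)
    ultimately obtain x where "x \<in> X" "\<forall>\<^sub>F y in regular_filter (principal {x}). y \<in> S"
      using eventually_happens' by blast
    then have "embed x \<in> extent S"
      using embed_in_completion[of x] by (simp add: extent_iff completion_map_eq_regular_filter)
    then show ?thesis using S(2) \<open>x \<in> X\<close> by blast
  qed
  then show ?thesis
    unfolding closure_of_def topspace_completion_space by auto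
qed

lemma continuous_map_embed: "continuous_map (uniform_topology X pair_uniformity) completion_space embed"
  unfolding continuous_map_def topspace_completion_space topspace_pair_topology
proof (intro conjI allI impI)
  show "embed \<in> X \<rightarrow> completion" using embed_in_completion by blast
  fix \<G> assume \<G>: "openin completion_space \<G>"
  show "openin (uniform_topology X pair_uniformity) {x \<in> X. embed x \<in> \<G>}"
    unfolding openin_pair_topology
  proof (intro conjI ballI)
    fix x assume "x \<in> {x \<in> X. embed x \<in> \<G>}"
    then have x: "x \<in> X" "regular_filter (principal {x}) \<in> \<G>"
      by (auto simp: completion_map_eq_regular_filter)
    then obtain S where S: "\<forall>\<^sub>F y in regular_filter (principal {x}). y \<in> S" "extent S \<subseteq> \<G>"
      using \<G> unfolding openin_completion_space by blast
    show "\<forall>\<^sub>F y in regular_filter (principal {x}). y \<in> {x \<in> X. embed x \<in> \<G>}"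
      using regular_filter_interior[OF cauchy_principal[OF x(1)] S(1)]
    proof (rule eventually_mono)
      fix y assume y: "y \<in> X \<and> (\<forall>\<^sub>F z in regular_filter (principal {y}). z \<in> S)"
      then have "embed y \<in> extent S"
        using embed_in_completion[of y] by (simp add: extent_iff completion_map_eq_regular_filter)
      then show "y \<in> {x \<in> X. embed x \<in> \<G>}" using S(2) y by blast
    qed
  qed blast
qed

text \<open>This computes the preimages of the basic open sets, which shows that the canonical map is open
  onto its image.\<close>

lemma embed_extent_iff:
  assumes "openin (uniform_topology X pair_uniformity) G" "x \<in> X"
  shows "embed x \<in> extent G \<longleftrightarrow> x \<in> G"
proof
  assume "embed x \<in> extent G"
  then have "\<forall>\<^sub>F y in regular_filter (principal {x}). y \<in> G"
    using assms by (simp add: extent_iff completion_map_eq_regular_filter)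
  then show "x \<in> G"
    by (rule eventually_regular_filter_point[OF assms(2)])
next
  assume "x \<in> G"
  then show "embed x \<in> extent G"
    using assms embed_in_completion[of x]
    by (simp add: extent_iff completion_map_eq_regular_filter openin_pair_topology)
qed

lemma embedding_map_embed:
  assumes separating: "\<And>x y. \<lbrakk>x \<in> X; y \<in> X; x \<noteq> y\<rbrakk> \<Longrightarrow> \<exists>A B. (A, B) \<in> R \<and> x \<notin> B \<and> y \<notin> A"
  shows "embedding_map (uniform_topology X pair_uniformity) completion_space embed"
  unfolding embedding_map_def topspace_pair_topology
proof (rule bijective_open_imp_homeomorphic_map)
  show "inj_on embed (topspace (uniform_topology X pair_uniformity))"
    unfolding topspace_pair_topology
  proof (rule inj_onI, rule ccontr)
    fix x y assume xy: "x \<in> X" "y \<in> X" "embed x = embed y" "x \<noteq> y"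
    then obtain A B where AB: "(A, B) \<in> R" "x \<notin> B" "y \<notin> A" using separating by blast
    have "\<forall>\<^sub>F z in regular_filter (principal {x}). z \<in> A"
      using AB by (intro regular_filterI[OF AB(1)]) (simp add: eventually_principal)
    then have "\<forall>\<^sub>F z in regular_filter (principal {y}). z \<in> A"
      using xy by (simp add: completion_map_eq_regular_filter)
    then show False
      using AB(3) eventually_regular_filter_point[OF xy(2)] by blast
  qed
  show "continuous_map (uniform_topology X pair_uniformity)
      (subtopology completion_space (embed ` X)) embed"
    using continuous_map_embed by (simp add: continuous_map_in_subtopology topspace_pair_topology image_subset_iff_funcset)
  show "open_map (uniform_topology X pair_uniformity) (subtopology completion_space (embed ` X)) embed"
    unfolding open_map_def
  proof (intro allI impI)
    fix G assume G: "openin (uniform_topology X pair_uniformity) G"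
    have "embed ` G = extent G \<inter> embed ` X"
      using embed_extent_iff[OF G] G by (auto simp: openin_pair_topology)
    then show "openin (subtopology completion_space (embed ` X)) (embed ` G)"
      using openin_extent by (auto simp: openin_subtopology)
  qed
  show "embed ` topspace (uniform_topology X pair_uniformity) = topspace (subtopology completion_space (embed ` X))"
    using embed_in_completion by (auto simp: topspace_completion_space topspace_pair_topology)
qed

lemma regular_filter_eq_embed:
  assumes "x \<in> X" "cauchy F" "principal {x} \<le> F"
  shows "regular_filter F = embed x"
  using regular_filter_cong[OF cauchy_principal[OF assms(1)] assms(2,3)] assms(1)
  by (simp add: completion_map_eq_regular_filter)


text \<open>The hypothesis \<open>split\<close> says that \<open>\<eta>\<close> carries the members of a pair to traces of open sets that cover \<open>K\<close>, which
  is uniform continuity from \<open>\<eta>  X\<close> to \<open>X\<close>. A point \<open>k\<close> is sent to the regular filter of the trace of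
  its neighbourhoods on \<open>X\<close>, which is proper because \<open>\<eta>  X\<close> is dense.\<close>

lemma continuous_extension:
  fixes K :: "'k topology" and \<eta> :: "'a \<Rightarrow> 'k"
  assumes \<eta>: "\<eta> \<in> X \<rightarrow> topspace K" and dense: "K closure_of (\<eta> ` X) = topspace K"
    and split: "\<And>A B. (A, B) \<in> R \<Longrightarrow> \<exists>V W. openin K V \<and> openin K W \<and> V \<union> W = topspace K \<and>
      (\<forall>x\<in>X. (\<eta> x \<in> V \<longrightarrow> x \<in> A) \<and> (\<eta> x \<in> W \<longrightarrow> x \<in> B))"
  shows "\<exists>f. continuous_map K completion_space f \<and> (\<forall>x\<in>X. f (\<eta> x) = embed x)"
proof -
  define trace where "trace = (\<lambda>k. inf (filtercomap \<eta> (nhdsin K k)) (principal X))"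
  have traceI: "eventually P (trace k)"
    if "openin K S" "k \<in> S" "\<And>x. x \<in> X \<Longrightarrow> \<eta> x \<in> S \<Longrightarrow> P x" for P k S
    unfolding trace_def eventually_inf_principal eventually_filtercomap eventually_nhdsin
    using that by (intro exI[of _ "\<lambda>y. y \<in> S"]) blast
  have traceD: "\<exists>S. openin K S \<and> k \<in> S \<and> (\<forall>x\<in>X. \<eta> x \<in> S \<longrightarrow> P x)"
    if "eventually P (trace k)" "k \<in> topspace K" for P k
    using that unfolding trace_def eventually_inf_principal eventually_filtercomap eventually_nhdsin
    by blast
  have trace_cauchy: "cauchy (trace k)" if k: "k \<in> topspace K" for k
    unfolding cauchy_iff
  proof (intro conjI allI impI)
    show "trace k \<noteq> bot"
    proof
      assume "trace k = bot"
      then have "\<forall>\<^sub>F x in trace k. False" by simp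
      then obtain S where S: "openin K S" "k \<in> S" "\<forall>x\<in>X. \<eta> x \<in> S \<longrightarrow> False"
        using traceD[OF _ k] by blast
      have "k \<in> K closure_of (\<eta> ` X)" using dense k by simp
      then show False
        using S unfolding in_closure_of by blast
    qed
    show "\<forall>\<^sub>F x in trace k. x \<in> X"
      by (rule traceI[OF openin_topspace k])
    fix A B assume "(A, B) \<in> R"
    then obtain V W where VW: "openin K V" "openin K W" "V \<union> W = topspace K"
      "\<forall>x\<in>X. (\<eta> x \<in> V \<longrightarrow> x \<in> A) \<and> (\<eta> x \<in> W \<longrightarrow> x \<in> B)"
      using split by meson
    then consider "k \<in> V" | "k \<in> W" using k by blast
    then show "(\<forall>\<^sub>F x in trace k. x \<in> A) \<or> (\<forall>\<^sub>F x in trace k. x \<in> B)"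
    proof cases
      case 1
      have "\<forall>\<^sub>F x in trace k. x \<in> A" by (rule traceI[OF VW(1) 1]) (use VW(4) in blast)
      then show ?thesis ..
    next
      case 2
      have "\<forall>\<^sub>F x in trace k. x \<in> B" by (rule traceI[OF VW(2) 2]) (use VW(4) in blast)
      then show ?thesis ..
    qed
  qed
  have "continuous_map K completion_space (\<lambda>k. regular_filter (trace k))"
  proof (rule continuous_map_regular_filter[OF trace_cauchy])
    fix A B k assume AB: "(A, B) \<in> R" and k: "k \<in> topspace K" "\<not> (\<forall>\<^sub>F x in trace k. x \<in> B)"
    obtain V W where VW: "openin K V" "openin K W" "V \<union> W = topspace K"
      "\<forall>x\<in>X. (\<eta> x \<in> V \<longrightarrow> x \<in> A) \<and> (\<eta> x \<in> W \<longrightarrow> x \<in> B)"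
      using split[OF AB] by meson
    have "\<forall>\<^sub>F x in trace k. x \<in> B" if "k \<in> W"
      by (rule traceI[OF VW(2) that]) (use VW(4) in blast)
    then have "k \<in> V" using VW(3) k by blast
    moreover have "\<forall>\<^sub>F x in trace k'. x \<in> A" if "k' \<in> V" for k'
      by (rule traceI[OF VW(1) that]) (use VW(4) in blast)
    ultimately show "\<exists>V. openin K V \<and> k \<in> V \<and> (\<forall>k'\<in>V. \<forall>\<^sub>F x in trace k'. x \<in> A)"
      using VW(1) by blast
  qed
  moreover have "regular_filter (trace (\<eta> x)) = embed x" if x: "x \<in> X" for x
  proof (rule regular_filter_eq_embed[OF x])
    have \<eta>x: "\<eta> x \<in> topspace K" using \<eta> x by blast
    show "cauchy (trace (\<eta> x))" by (rule trace_cauchy[OF \<eta>x])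
    show "principal {x} \<le> trace (\<eta> x)"
    proof (rule filter_leI)
      fix P assume "eventually P (trace (\<eta> x))"
      then have "P x" using traceD[OF _ \<eta>x] x by blast
      then show "eventually P (principal {x})" by (simp add: eventually_principal)
    qed
  qed
  ultimately show ?thesis by blast
qed


section \<open>Extension of a ternary operation\<close>

context
  fixes m :: "'a \<Rightarrow> 'a \<Rightarrow> 'a \<Rightarrow> 'a"
  assumes m_closed: "\<And>x y z. \<lbrakk>x \<in> X; y \<in> X; z \<in> X\<rbrakk> \<Longrightarrow> m x y z \<in> X"
    and two_of_three: "\<And>A B x y z. \<lbrakk>(A, B) \<in> R; x \<in> X; y \<in> X; z \<in> X;
      x \<in> A \<and> y \<in> A \<or> x \<in> A \<and> z \<in> A \<or> y \<in> A \<and> z \<in> A\<rbrakk> \<Longrightarrow> m x y z \<in> A"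
begin

definition triple_filter :: "'a filter \<Rightarrow> 'a filter \<Rightarrow> 'a filter \<Rightarrow> 'a filter"
  where "triple_filter F G H = filtermap (\<lambda>(x, y, z). m x y z) (F \<times>\<^sub>F (G \<times>\<^sub>F H))"

lemma eventually_triple_filter:
  assumes "eventually P F" "eventually Q G" "eventually S H"
    and "\<And>x y z. \<lbrakk>P x; Q y; S z\<rbrakk> \<Longrightarrow> T (m x y z)"
  shows "eventually T (triple_filter F G H)"
proof -
  have "\<forall>\<^sub>F p in F \<times>\<^sub>F (G \<times>\<^sub>F H). P (fst p) \<and> Q (fst (snd p)) \<and> S (snd (snd p))"
    using eventually_prodI[OF assms(1) eventually_prodI[OF assms(2,3)]] .
  then show ?thesis
    unfolding triple_filter_def eventually_filtermap
    by (rule eventually_mono) (auto intro: assms(4))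
qed

lemma triple_filter_branch:
  assumes AB: "(A, B) \<in> R" and c: "cauchy F" "cauchy G" "cauchy H"
    and two: "(\<forall>\<^sub>F x in F. x \<in> A) \<and> (\<forall>\<^sub>F x in G. x \<in> A) \<or> (\<forall>\<^sub>F x in F. x \<in> A) \<and> (\<forall>\<^sub>F x in H. x \<in> A) \<or>
      (\<forall>\<^sub>F x in G. x \<in> A) \<and> (\<forall>\<^sub>F x in H. x \<in> A)"
  shows "\<forall>\<^sub>F x in triple_filter F G H. x \<in> A"
proof -
  have X: "\<forall>\<^sub>F x in F. x \<in> X" "\<forall>\<^sub>F x in G. x \<in> X" "\<forall>\<^sub>F x in H. x \<in> X"
    using c by (auto simp: cauchy_iff)
  have sub: "A \<subseteq> X" using pair_cover[OF AB] by blast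
  consider "\<forall>\<^sub>F x in F. x \<in> A" "\<forall>\<^sub>F x in G. x \<in> A" | "\<forall>\<^sub>F x in F. x \<in> A" "\<forall>\<^sub>F x in H. x \<in> A"
    | "\<forall>\<^sub>F x in G. x \<in> A" "\<forall>\<^sub>F x in H. x \<in> A"
    using two by blast
  then show ?thesis
  proof cases
    case 1
    show ?thesis
      by (rule eventually_triple_filter[OF 1 X(3)]) (use two_of_three[OF AB] sub in blast)
  next
    case 2
    show ?thesis
      by (rule eventually_triple_filter[OF 2(1) X(2) 2(2)]) (use two_of_three[OF AB] sub in blast)
  next
    case 3
    show ?thesis
      by (rule eventually_triple_filter[OF X(1) 3]) (use two_of_three[OF AB] sub in blast)
  qed
qed

text \<open>Three filters vote on the two members of a pair, and two of the votes agree.\<close>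

lemma cauchy_triple_filter:
  assumes c: "cauchy F" "cauchy G" "cauchy H"
  shows "cauchy (triple_filter F G H)"
  unfolding cauchy_iff
proof (intro conjI allI impI)
  show "triple_filter F G H \<noteq> bot"
    using c by (simp add: triple_filter_def filtermap_bot_iff prod_filter_eq_bot cauchy_iff)
  show "\<forall>\<^sub>F x in triple_filter F G H. x \<in> X"
    by (rule eventually_triple_filter[of "\<lambda>x. x \<in> X" _ "\<lambda>x. x \<in> X" _ "\<lambda>x. x \<in> X"])
      (use c m_closed in \<open>auto simp: cauchy_iff\<close>)
  fix A B assume AB: "(A, B) \<in> R"
  have "\<forall>H\<in>{F, G, H}. (\<forall>\<^sub>F x in H. x \<in> A) \<or> (\<forall>\<^sub>F x in H. x \<in> B)"
    using cauchyD[OF _ AB] c by blast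
  then show "(\<forall>\<^sub>F x in triple_filter F G H. x \<in> A) \<or> (\<forall>\<^sub>F x in triple_filter F G H. x \<in> B)"
    using triple_filter_branch[OF AB c] triple_filter_branch[OF pair_sym[OF AB] c] by blast
qed

text \<open>For continuity at \<open>(F, G, H)\<close>, suppose that the image of the product filter omits \<open>B\<close>. Then at
  most one of the three filters contains \<open>B\<close>, so two of them contain \<open>A\<close>. This is an open
  condition on these two, and it puts \<open>A\<close> in the image filter of every nearby triple.\<close>

lemma ternary_extension:
  "\<exists>mh. continuous_map (prod_topology completion_space (prod_topology completion_space completion_space))
      completion_space (\<lambda>(F, G, H). mh F G H) \<and>
    (\<forall>x\<in>X. \<forall>y\<in>X. \<forall>z\<in>X. mh (embed x) (embed y) (embed z) = embed (m x y z))"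
proof (intro exI conjI ballI)
  let ?Z = "prod_topology completion_space (prod_topology completion_space completion_space)"
  let ?mh = "\<lambda>F G H. regular_filter (triple_filter F G H)"
  have "continuous_map ?Z completion_space (\<lambda>p. regular_filter (case p of (F, G, H) \<Rightarrow> triple_filter F G H))"
  proof (rule continuous_map_regular_filter)
    show "cauchy (case p of (F, G, H) \<Rightarrow> triple_filter F G H)" if "p \<in> topspace ?Z" for p
      using that cauchy_triple_filter by (auto simp: topspace_completion_space completion_iff)
    fix A B p
    assume AB: "(A, B) \<in> R" and p: "p \<in> topspace ?Z"
      and not: "\<not> (\<forall>\<^sub>F x in case p of (F, G, H) \<Rightarrow> triple_filter F G H. x \<in> B)"
    obtain F G H where FGH: "p = (F, G, H)" "F \<in> completion" "G \<in> completion" "H \<in> completion"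
      using p by (cases p) (auto simp: topspace_completion_space)
    then have c: "cauchy F" "cauchy G" "cauchy H" by (auto simp: completion_iff)
    define \<V> where "\<V> = {extent A \<times> extent A \<times> completion, extent A \<times> completion \<times> extent A,
      completion \<times> extent A \<times> extent A}"
    have op: "openin ?Z V" if "V \<in> \<V>" for V
      using that openin_extent openin_topspace[of completion_space]
      unfolding topspace_completion_space by (auto simp: \<V>_def openin_prod_Times_iff)
    have "\<not> ((\<forall>\<^sub>F x in F. x \<in> B) \<and> (\<forall>\<^sub>F x in G. x \<in> B)) \<and> \<not> ((\<forall>\<^sub>F x in F. x \<in> B) \<and> (\<forall>\<^sub>F x in H. x \<in> B)) \<and>
        \<not> ((\<forall>\<^sub>F x in G. x \<in> B) \<and> (\<forall>\<^sub>F x in H. x \<in> B))"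
      using not triple_filter_branch[OF pair_sym[OF AB] c] FGH(1) by auto
    then have "(F \<in> extent A \<and> G \<in> extent A) \<or> (F \<in> extent A \<and> H \<in> extent A) \<or> (G \<in> extent A \<and> H \<in> extent A)"
      using cauchyD[OF _ AB] c FGH unfolding extent_iff by blast
    then obtain V where V: "V \<in> \<V>" "p \<in> V"
      using FGH unfolding \<V>_def by blast
    have "\<forall>\<^sub>F x in case q of (F, G, H) \<Rightarrow> triple_filter F G H. x \<in> A" if "q \<in> V" for q
    proof -
      obtain F' G' H' where q: "q = (F', G', H')" by (cases q)
      have c': "cauchy F'" "cauchy G'" "cauchy H'"
        using V(1) that by (auto simp: q \<V>_def extent_iff completion_iff)
      show ?thesis
        unfolding q prod.case by (rule triple_filter_branch[OF AB c'])
          (use V(1) that in \<open>auto simp: q \<V>_def extent_iff\<close>)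
    qed
    then show "\<exists>V. openin ?Z V \<and> p \<in> V \<and>
        (\<forall>q\<in>V. \<forall>\<^sub>F x in case q of (F, G, H) \<Rightarrow> triple_filter F G H. x \<in> A)"
      using op V by blast
  qed
  moreover have "(\<lambda>p. regular_filter (case p of (F, G, H) \<Rightarrow> triple_filter F G H)) =
      (\<lambda>(F, G, H). ?mh F G H)"
    by auto
  ultimately show "continuous_map ?Z completion_space (\<lambda>(F, G, H). ?mh F G H)" by simp
  fix x y z assume xyz: "x \<in> X" "y \<in> X" "z \<in> X"
  show "?mh (embed x) (embed y) (embed z) = embed (m x y z)"
  proof (rule regular_filter_eq_embed)
    show "m x y z \<in> X" using m_closed xyz by blast
    show "cauchy (triple_filter (embed x) (embed y) (embed z))"
      using cauchy_triple_filter embed_in_completion xyz by (simp add: completion_iff)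
    have "principal {w} \<le> embed w" if "w \<in> X" for w
      using le_regular_filter[of "principal {w}" "principal {w}"] that cauchy_principal
      by (simp add: completion_map_eq_regular_filter)
    then have "principal {x} \<times>\<^sub>F (principal {y} \<times>\<^sub>F principal {z}) \<le> embed x \<times>\<^sub>F (embed y \<times>\<^sub>F embed z)"
      using xyz by (intro prod_filter_mono) auto
    then have "filtermap (\<lambda>(x, y, z). m x y z) (principal {x} \<times>\<^sub>F (principal {y} \<times>\<^sub>F principal {z})) \<le>
        triple_filter (embed x) (embed y) (embed z)"
      unfolding triple_filter_def by (rule filtermap_mono)
    then show "principal {m x y z} \<le> triple_filter (embed x) (embed y) (embed z)"
      by (simp add: principal_prod_principal)
  qed
qed

end

end


section \<open>Branches of a median algebra\<close>

lemma linear_order_on_comparable: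
  "\<lbrakk>linear_order_on A r; x \<in> A; y \<in> A\<rbrakk> \<Longrightarrow> (x, y) \<in> r \<or> (y, x) \<in> r"
  unfolding linear_order_on_def partial_order_on_def preorder_on_def
  by (cases "x = y") (auto simp: refl_on_def total_on_def)

context median_algebra
begin

lemma sym13: "\<lbrakk>a \<in> X; b \<in> X; c \<in> X\<rbrakk> \<Longrightarrow> m a b c = m c b a"
  by (metis sym12 sym23)

lemma rotate: "\<lbrakk>a \<in> X; b \<in> X; c \<in> X\<rbrakk> \<Longrightarrow> m a b c = m b c a"
  by (metis sym12 sym23)

lemma absorb: "\<lbrakk>a \<in> X; b \<in> X\<rbrakk> \<Longrightarrow> m b a b = b" "\<lbrakk>a \<in> X; b \<in> X\<rbrakk> \<Longrightarrow> m b b a = b"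
  by (metis majority sym12, metis majority sym12 sym23)

lemma retract:
  assumes "a \<in> X" "b \<in> X" "c \<in> X" shows "m a b (m a b c) = m a b c"
proof -
  have "m b a (m b a c) = m (m b a b) a c"
    using assoc[of b b c a] assms by simp
  then have "m b a (m b a c) = m b a c"
    using assms by (simp add: absorb)
  then show ?thesis using assms closed by (simp add: sym12[of a b])
qed

lemma median_interval_commute: "\<lbrakk>u \<in> X; v \<in> X\<rbrakk> \<Longrightarrow> median_interval X m u v = median_interval X m v u"
  unfolding median_interval_def using sym12 by auto

text \<open>The median of \<open>x\<close>, \<open>y\<close>, \<open>v\<close> is the point of the interval \<open>[x, y]\<close> nearest to \<open>v\<close>: it lies between \<open>v\<close>
  and every \<open>q\<close> of the interval. With \<open>p\<close> for this median and \<open>s = m v x q\<close>, the axioms give that \<open>s\<close> lies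
  between \<open>x\<close> and \<open>p\<close>, and \<open>p\<close> between \<open>x\<close> and \<open>v\<close>; hence \<open>p\<close> lies between \<open>s\<close> and \<open>v\<close>. Since
  \<open>p\<close> also lies between \<open>x\<close> and \<open>v\<close>, replacing \<open>s\<close> by \<open>q\<close> changes nothing.\<close>

lemma gate:
  assumes X: "x \<in> X" "y \<in> X" "v \<in> X" "q \<in> X" and q: "m x y q = q"
  shows "m (m x y v) v q = m x y v"
proof -
  define p where "p = m x y v"
  define s where "s = m v x q"
  have pX: "p \<in> X" and sX: "s \<in> X" using X closed by (auto simp: p_def s_def)
  have vxp: "m v x p = p"
    using retract[of x v y] X sym12 sym23 closed by (metis p_def)
  have "m p x q = m v x (m y x q)"
    using assoc[of v y q x] X closed sym12 sym23 by (metis p_def)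
  then have "m p x q = s"
    using q X sym12 by (metis s_def)
  then have pxs: "m p x s = s"
    using retract[of p x q] X pX by metis
  have "m v p s = m v p (m x p s)"
    using pxs X pX sX sym12 by metis
  also have "\<dots> = m (m v p x) p s"
    using assoc[of v x s p] X pX sX by simp
  also have "m v p x = p"
    using vxp X pX sym23 by metis
  also have "m p p s = p"
    using absorb pX sX by simp
  finally have vps: "m v p s = p" .
  have "m p v q = m (m p v x) v q"
    using vxp X pX rotate by metis
  also have "\<dots> = m p v (m x v q)"
    using assoc[of p x q v] X pX by simp
  also have "\<dots> = p"
    using vps X pX sX sym12 by (metis s_def)
  finally show ?thesis by (simp add: p_def)
qed

lemma retraction_in_interval:
  "\<lbrakk>u \<in> X; v \<in> X; x \<in> X\<rbrakk> \<Longrightarrow> m u x v \<in> median_interval X m u v"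
  using closed retract[of u v x] sym23 by (simp add: median_interval_def)

lemma endpoints_in_interval:
  "\<lbrakk>u \<in> X; v \<in> X\<rbrakk> \<Longrightarrow> u \<in> median_interval X m u v" "\<lbrakk>u \<in> X; v \<in> X\<rbrakk> \<Longrightarrow> v \<in> median_interval X m u v"
  using absorb majority by (auto simp: median_interval_def)

lemma chain_interval_commute:
  "nontrivial_chain_interval X m u v \<Longrightarrow> nontrivial_chain_interval X m v u"
  using median_interval_commute by (auto simp: nontrivial_chain_interval_def)

text \<open>The position of the two points relative to both endpoints at once, freed from the choice of the
  linear order, which may run from \<open>u\<close> to \<open>v\<close> or from \<open>v\<close> to \<open>u\<close>.\<close>

lemma chain_interval_comparable:
  assumes uv: "nontrivial_chain_interval X m u v"
    and a: "a \<in> median_interval X m u v" and b: "b \<in> median_interval X m u v"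
  shows "m u a b = a \<and> m v a b = b \<or> m u a b = b \<and> m v a b = a"
proof -
  let ?I = "median_interval X m u v"
  have X: "u \<in> X" "v \<in> X" "a \<in> X" "b \<in> X"
    using uv a b by (auto simp: nontrivial_chain_interval_def median_interval_def)
  obtain r where r: "linear_order_on ?I r" and betw: "\<And>a b c. (a, b) \<in> r \<Longrightarrow> (b, c) \<in> r \<Longrightarrow> m a b c = b"
    using uv by (auto simp: nontrivial_chain_interval_def median_chain_def)
  have total: "(x, y) \<in> r \<or> (y, x) \<in> r" if "x \<in> ?I" "y \<in> ?I" for x y
    using linear_order_on_comparable[OF r that] .
  have ends: "u \<in> ?I" "v \<in> ?I" using endpoints_in_interval X by auto
  \<comment> \<open>Here \<open>p\<close> is the endpoint that is least for the order \<open>r\<close>, and \<open>q\<close> the other one.\<close>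
  have *: "m p x y = x \<and> m q x y = y"
    if pq: "(p, q) \<in> r" "{p, q} = {u, v}" and xy: "x \<in> ?I" "y \<in> ?I" "(x, y) \<in> r" for p q x y
  proof -
    have pqX: "p \<in> ?I" "q \<in> ?I" "p \<in> X" "q \<in> X" using pq(2) ends X by (auto simp: doubleton_eq_iff)
    have xyX: "x \<in> X" "y \<in> X" using xy by (auto simp: median_interval_def)
    have btw: "m p q z = z" if "z \<in> ?I" for z
      using that pq(2) X sym12 by (auto simp: median_interval_def doubleton_eq_iff)
    have "(p, x) \<in> r"
    proof (cases "(x, p) \<in> r")
      case True
      then have "m x p q = p" using betw pq(1) by blast
      then have "x = p" using btw[OF xy(1)] xyX pqX rotate by metis
      then show ?thesis using True by simp
    qed (use total[OF xy(1) pqX(1)] in blast)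
    moreover have "(y, q) \<in> r"
    proof (cases "(q, y) \<in> r")
      case True
      then have "m p q y = q" using betw pq(1) by blast
      then have "y = q" using btw[OF xy(2)] by simp
      then show ?thesis using True by simp
    qed (use total[OF xy(2) pqX(2)] in blast)
    ultimately have "m p x y = x" "m x y q = y" using betw xy(3) by blast+
    then show ?thesis using xyX pqX rotate by metis
  qed
  have abba: "m u b a = m u a b" "m v b a = m v a b" using X sym23 by auto
  consider "(u, v) \<in> r" "(a, b) \<in> r" | "(u, v) \<in> r" "(b, a) \<in> r" | "(v, u) \<in> r" "(a, b) \<in> r"
    | "(v, u) \<in> r" "(b, a) \<in> r"
    using total ends a b by blast
  then show ?thesis
  proof cases
    case 1
    show ?thesis using *[OF 1(1) refl a b 1(2)] by simp
  next
    case 2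
    show ?thesis using *[OF 2(1) refl b a 2(2)] abba by simp
  next
    case 3
    show ?thesis using *[OF 3(1) insert_commute a b 3(2)] by simp
  next
    case 4
    show ?thesis using *[OF 4(1) insert_commute b a 4(2)] abba by simp
  qed
qed

text \<open>Let \<open>p = m x y v\<close>. In the semilattice \<open>m a v b\<close> with least element \<open>v\<close>, the meet of \<open>p\<close> with \<open>u\<close> is the meet of
  the positions of \<open>x\<close> and \<open>y\<close>, hence one of them since they lie in a chain, so it is not \<open>v\<close>. By the
  gate property \<open>p\<close> lies between \<open>v\<close> and \<open>m x y z\<close>. If the position of \<open>m x y z\<close> were \<open>v\<close>, then so would be that
  of \<open>p\<close>.\<close>

lemma branch_median:
  assumes uv: "nontrivial_chain_interval X m u v"
    and x: "x \<in> branch X m u v" and y: "y \<in> branch X m u v" and z: "z \<in> X"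
  shows "m x y z \<in> branch X m u v"
proof -
  have X: "u \<in> X" "v \<in> X" "x \<in> X" "y \<in> X"
    using uv x y by (auto simp: nontrivial_chain_interval_def branch_def)
  define p where "p = m x y v"
  define q where "q = m x y z"
  have pX: "p \<in> X" and qX: "q \<in> X" using X z closed by (auto simp: p_def q_def)
  let ?a = "m u x v" and ?b = "m u y v"
  have aX: "?a \<in> X" "?b \<in> X" using X closed by auto
  have "m v ?a ?b = ?a \<or> m v ?a ?b = ?b"
    using chain_interval_comparable[OF uv retraction_in_interval retraction_in_interval] X by blast
  then have "m ?a v ?b \<noteq> v"
    using x y aX X sym12 by (metis (mono_tags, lifting) branch_def mem_Collect_eq)
  moreover have "m ?a v ?b = m u v p"
  proof -
    have "m ?a v ?b = m (m x v u) v (m u v y)"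
      using X sym13 sym23 rotate by metis
    also have "\<dots> = m x v (m u v (m u v y))"
      using assoc[of x u "m u v y" v] X closed by simp
    also have "\<dots> = m x v (m u v y)"
      using retract X by simp
    also have "\<dots> = m (m x v u) v y"
      using assoc[of x u y v] X by simp
    also have "\<dots> = m (m u v x) v y"
      using X sym13 by metis
    also have "\<dots> = m u v (m x v y)"
      using assoc[of u x y v] X by simp
    finally show ?thesis using X sym23 by (simp add: p_def)
  qed
  ultimately have "m u v p \<noteq> v" by simp
  have "m x y q = q"
    using retract X z by (simp add: q_def)
  then have "m p v q = p"
    using gate X qX by (simp add: p_def)
  have "m u q v \<noteq> v"
  proof
    assume *: "m u q v = v"
    have "m u v p = m u v (m q v p)"
      using \<open>m p v q = p\<close> pX qX X sym13 by metis
    also have "\<dots> = m (m u v q) v p"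
      using assoc[of u q p v] X pX qX by simp
    also have "\<dots> = v"
      using * X pX qX sym23 absorb by metis
    finally show False using \<open>m u v p \<noteq> v\<close> by simp
  qed
  then show ?thesis using qX by (simp add: branch_def q_def)
qed

lemma initial_interval_subset:
  assumes "u \<in> X" "v \<in> X" "w \<in> median_interval X m u v"
  shows "median_interval X m u w \<subseteq> median_interval X m u v"
proof
  fix z assume "z \<in> median_interval X m u w"
  then have z: "z \<in> X" "m u w z = z" by (auto simp: median_interval_def)
  have w: "w \<in> X" "m u v w = w" using assms by (auto simp: median_interval_def)
  have "m v u z = m v u (m w u z)"
    using z w assms sym12 by metis
  also have "\<dots> = m (m v u w) u z"
    using assoc[of v w z u] z w assms by simp
  also have "\<dots> = z"
    using z w assms sym12 by metis
  finally show "z \<in> median_interval X m u v"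
    using z assms sym12 by (simp add: median_interval_def)
qed

lemma initial_chain_interval:
  assumes uv: "nontrivial_chain_interval X m u v"
    and w: "w \<in> median_interval X m u v" "w \<noteq> u"
  shows "nontrivial_chain_interval X m u w"
proof -
  let ?I = "median_interval X m u w" and ?J = "median_interval X m u v"
  have X: "u \<in> X" "v \<in> X" "w \<in> X"
    using uv w by (auto simp: nontrivial_chain_interval_def median_interval_def)
  have sub: "?I \<subseteq> ?J" using initial_interval_subset X w by simp
  obtain r where r: "linear_order_on ?J r" and betw: "\<And>a b c. (a, b) \<in> r \<Longrightarrow> (b, c) \<in> r \<Longrightarrow> m a b c = b"
    using uv by (auto simp: nontrivial_chain_interval_def median_chain_def)
  have total: "(x, y) \<in> r \<or> (y, x) \<in> r" if "x \<in> ?I" "y \<in> ?I" for x y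
    using linear_order_on_comparable[OF r, of x y] that sub by blast
  have in3: "m a b c \<in> {a, b, c}" if abc: "a \<in> ?I" "b \<in> ?I" "c \<in> ?I" for a b c
  proof -
    have "a \<in> X" "b \<in> X" "c \<in> X" using abc by (auto simp: median_interval_def)
    then have perm: "m a b c = m b a c" "m a b c = m a c b" "m a b c = m c b a" "m a b c = m b c a"
        "m a b c = m c a b"
      using sym12 sym23 sym13 rotate by metis+
    consider "(a, b) \<in> r" "(b, c) \<in> r" | "(a, c) \<in> r" "(c, b) \<in> r" | "(b, a) \<in> r" "(a, c) \<in> r"
      | "(b, c) \<in> r" "(c, a) \<in> r" | "(c, a) \<in> r" "(a, b) \<in> r" | "(c, b) \<in> r" "(b, a) \<in> r"
      using total abc by blast
    then show ?thesis
      using betw[of a b c] betw[of a c b] betw[of b a c] betw[of b c a] betw[of c a b] betw[of c b a]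
      by cases (simp_all add: perm[symmetric])
  qed
  have "m a b c \<in> ?I" if "a \<in> ?I" "b \<in> ?I" "c \<in> ?I" for a b c
    using in3[OF that] that by auto
  moreover have "?I \<subseteq> X" by (auto simp: median_interval_def)
  ultimately have "median_subalgebra X m ?I"
    unfolding median_subalgebra_def by blast
  moreover have "linear_order_on ?I (Restr r ?I)"
    using r sub unfolding order_on_defs
    by (auto simp: refl_on_def total_on_def subset_eq intro: trans_Restr antisym_Restr)
  ultimately have "median_chain X m ?I"
    unfolding median_chain_def using betw by (intro conjI exI[of _ "Restr r ?I"]) auto
  then show ?thesis
    using X w(2) by (simp add: nontrivial_chain_interval_def)
qed

text \<open>The position of \<open>x\<close> relative to \<open>[u, w]\<close> is the lesser of \<open>w\<close> and its position relative to
  \<open>[u, v]\<close>. It is \<open>u\<close> iff the latter is \<open>u\<close>, since \<open>w \<noteq> u\<close> and the interval is a chain.\<close>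

lemma initial_branch:
  assumes uv: "nontrivial_chain_interval X m u v"
    and w: "w \<in> median_interval X m u v" "w \<noteq> u"
  shows "branch X m w u = branch X m v u"
proof -
  have X: "u \<in> X" "v \<in> X" "w \<in> X" and uvw: "m u v w = w"
    using uv w by (auto simp: nontrivial_chain_interval_def median_interval_def)
  have "m w x u = u \<longleftrightarrow> m v x u = u" if x: "x \<in> X" for x
  proof -
    have vX: "m u x v \<in> X" using closed X x by simp
    have "m w x u = m (m w u v) u x"
      using uvw X x rotate sym12 sym23 by metis
    also have "\<dots> = m w u (m v u x)"
      using assoc[of w v x u] X x by simp
    also have "\<dots> = m u w (m u x v)"
      using X x closed sym12 sym23 rotate by metis
    finally have "m w x u = m u w (m u x v)" .
    moreover have "m u w (m u x v) = w \<or> m u w (m u x v) = m u x v"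
      using chain_interval_comparable[OF uv w(1) retraction_in_interval] X x by blast
    moreover have "m v x u = m u x v" using X x sym13 by simp
    ultimately show ?thesis
      using w(2) X majority absorb by metis
  qed
  then show ?thesis by (auto simp: branch_def)
qed

text \<open>In a chain the position of \<open>x\<close> cannot lie on both sides of \<open>w\<close>.\<close>

lemma branches_disjoint_at:
  assumes uv: "nontrivial_chain_interval X m u v" and w: "w \<in> median_interval X m u v"
  shows "branch X m u w \<inter> branch X m v w = {}"
proof -
  have X: "u \<in> X" "v \<in> X" "w \<in> X" and uvw: "m u v w = w"
    using uv w by (auto simp: nontrivial_chain_interval_def median_interval_def)
  have "m u x w = w \<or> m v x w = w" if x: "x \<in> X" for x
  proof -
    let ?c = "m u x v"
    have cX: "?c \<in> X" using closed X x by simp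
    have "m u x w = m (m w u v) u x"
      using uvw X x rotate sym12 sym23 by metis
    also have "\<dots> = m w u (m v u x)"
      using assoc[of w v x u] X x by simp
    also have "\<dots> = m u w ?c"
      using X x closed sym12 sym23 rotate by metis
    finally have u: "m u x w = m u w ?c" .
    have "m v x w = m (m w v u) v x"
      using uvw X x rotate sym12 sym23 by metis
    also have "\<dots> = m w v (m u v x)"
      using assoc[of w u x v] X x by simp
    also have "\<dots> = m v w ?c"
      using X x closed sym12 sym23 rotate by metis
    finally have v: "m v x w = m v w ?c" .
    show ?thesis
      unfolding u v using chain_interval_comparable[OF uv w retraction_in_interval] X x by blast
  qed
  then show ?thesis by (auto simp: branch_def)
qed

definition branch_pairs :: "('a set \<times> 'a set) set"
  where "branch_pairs = {(branch X m u v, branch X m v u) | u v. nontrivial_chain_interval X m u v}"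

lemma branch_normal:
  assumes uv: "nontrivial_chain_interval X m u v"
  shows "\<exists>C D. (C, branch X m v u) \<in> branch_pairs \<and> (branch X m u v, D) \<in> branch_pairs \<and> C \<inter> D = {}"
proof (cases "\<exists>w\<in>median_interval X m u v. w \<noteq> u \<and> w \<noteq> v")
  case True
  then obtain w where w: "w \<in> median_interval X m u v" "w \<noteq> u" "w \<noteq> v" by blast
  have vu: "nontrivial_chain_interval X m v u" by (rule chain_interval_commute[OF uv])
  have w': "w \<in> median_interval X m v u"
    using w(1) median_interval_commute uv by (auto simp: nontrivial_chain_interval_def)
  have "(branch X m u w, branch X m v u) \<in> branch_pairs"
    using initial_chain_interval[OF uv w(1,2)] initial_branch[OF uv w(1,2)]
    by (auto simp: branch_pairs_def)
  moreover have "(branch X m u v, branch X m v w) \<in> branch_pairs"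
    using chain_interval_commute[OF initial_chain_interval[OF vu w' w(3)]] initial_branch[OF vu w' w(3)]
    by (auto simp: branch_pairs_def)
  ultimately show ?thesis
    using branches_disjoint_at[OF uv w(1)] by blast
next
  case False
  have X: "u \<in> X" "v \<in> X" using uv by (auto simp: nontrivial_chain_interval_def)
  have "branch X m u v \<inter> branch X m v u = {}"
  proof (rule equals0I)
    fix x assume "x \<in> branch X m u v \<inter> branch X m v u"
    then have x: "x \<in> X" "m u x v \<noteq> v" "m v x u \<noteq> u" by (auto simp: branch_def)
    then have "m u x v \<noteq> u" using X sym13[of v x u] by simp
    then show False using False retraction_in_interval[OF X x(1)] x(2) by blast
  qed
  moreover have "(branch X m u v, branch X m v u) \<in> branch_pairs"
    using uv by (auto simp: branch_pairs_def)
  ultimately show ?thesis by blast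
qed

sublocale branches: normal_pairs X branch_pairs
proof
  fix A B assume "(A, B) \<in> branch_pairs"
  then obtain u v where AB: "A = branch X m u v" "B = branch X m v u"
    and uv: "nontrivial_chain_interval X m u v"
    by (auto simp: branch_pairs_def)
  show "A \<union> B = X"
    using is_cover_branches[OF uv] by (simp add: AB is_cover_def)
  show "(B, A) \<in> branch_pairs"
    using chain_interval_commute[OF uv] by (auto simp: AB branch_pairs_def)
  show "\<exists>C D. (C, B) \<in> branch_pairs \<and> (A, D) \<in> branch_pairs \<and> C \<inter> D = {}"
    using branch_normal[OF uv] by (simp add: AB)
qed

lemma median_uniformity_eq: "median_uniformity X m = branches.pair_uniformity"
proof -
  have "{{branch X m u v, branch X m v u} | u v. nontrivial_chain_interval X m u v} = branches.pair_covers"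
    unfolding branches.pair_covers_def unfolding branch_pairs_def by blast
  then show ?thesis by (simp add: median_uniformity_def)
qed

lemma branch_two_of_three:
  assumes "(A, B) \<in> branch_pairs" and X: "x \<in> X" "y \<in> X" "z \<in> X"
    and two: "x \<in> A \<and> y \<in> A \<or> x \<in> A \<and> z \<in> A \<or> y \<in> A \<and> z \<in> A"
  shows "m x y z \<in> A"
proof -
  obtain u v where A: "A = branch X m u v" and uv: "nontrivial_chain_interval X m u v"
    using assms(1) by (auto simp: branch_pairs_def)
  have "m x y z = m x z y" "m x y z = m y z x" using X sym23 rotate by auto
  then show ?thesis
    using two branch_median[OF uv] X by (metis A)
qed

lemma T2_separating:
  assumes "T2_median X m" "x \<in> X" "y \<in> X" "x \<noteq> y"
  shows "\<exists>A B. (A, B) \<in> branch_pairs \<and> x \<notin> B \<and> y \<notin> A"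
proof -
  obtain u v where uv: "nontrivial_chain_interval X m u v" and eq: "{m u x v, m u y v} = {u, v}"
    using assms unfolding T2_median_def median_retraction_def by blast
  have X: "u \<in> X" "v \<in> X" using uv by (auto simp: nontrivial_chain_interval_def)
  have sym: "m v x u = m u x v" "m v y u = m u y v" using X assms sym13 by auto
  have "m u x v = u \<and> m u y v = v \<or> m u x v = v \<and> m u y v = u"
    using eq by (auto simp: doubleton_eq_iff)
  then show ?thesis
  proof
    assume "m u x v = u \<and> m u y v = v"
    then show ?thesis
      using uv sym by (intro exI[of _ "branch X m u v"] exI[of _ "branch X m v u"])
        (auto simp: branch_pairs_def branch_def)
  next
    assume "m u x v = v \<and> m u y v = u"
    then show ?thesis
      using chain_interval_commute[OF uv] sym
      by (intro exI[of _ "branch X m v u"] exI[of _ "branch X m u v"])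
        (auto simp: branch_pairs_def branch_def)
  qed
qed

end


section \<open>Identities on dense subalgebras\<close>

lemma continuous_map_median:
  assumes "topological_median_algebra Y n"
    and "continuous_map W Y p" "continuous_map W Y q" "continuous_map W Y r"
  shows "continuous_map W Y (\<lambda>w. n (p w) (q w) (r w))"
proof -
  have "continuous_map W (prod_topology Y (prod_topology Y Y)) (\<lambda>w. (p w, q w, r w))"
    by (intro continuous_map_pairedI assms)
  then have "continuous_map W Y ((\<lambda>(x, y, z). n x y z) \<circ> (\<lambda>w. (p w, q w, r w)))"
    using assms(1) unfolding topological_median_algebra_def by (blast intro: continuous_map_compose)
  then show ?thesis by (simp add: o_def)
qed

text \<open>Four variables suffice for every axiom of a median algebra; identities in fewer variables have
  dummy arguments.\<close>

lemma identity_from_dense: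
  fixes Z :: "'a topology" and Y :: "'b topology"
  defines "Z4 \<equiv> prod_topology Z (prod_topology Z (prod_topology Z Z))"
  assumes dense: "Z closure_of S = topspace Z" and Y: "Hausdorff_space Y"
    and f: "continuous_map Z4 Y (\<lambda>p. f (fst p) (fst (snd p)) (fst (snd (snd p))) (snd (snd (snd p))))"
    and g: "continuous_map Z4 Y (\<lambda>p. g (fst p) (fst (snd p)) (fst (snd (snd p))) (snd (snd (snd p))))"
    and eq: "\<And>a b c d. \<lbrakk>a \<in> S; b \<in> S; c \<in> S; d \<in> S\<rbrakk> \<Longrightarrow> f a b c d = g a b c d"
    and mem: "a \<in> topspace Z" "b \<in> topspace Z" "c \<in> topspace Z" "d \<in> topspace Z"
  shows "f a b c d = g a b c d"
proof -
  have "(a, b, c, d) \<in> Z4 closure_of (S \<times> S \<times> S \<times> S)"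
    using mem by (simp add: Z4_def closure_of_Times dense)
  from forall_in_closure_of_eq[OF this Y f g] eq show ?thesis by auto
qed

lemma continuous_map_of_snd:
  "continuous_map B D h \<Longrightarrow> continuous_map (prod_topology A B) D (\<lambda>p. h (snd p))"
  using continuous_map_compose[OF continuous_map_snd, of B D h A] by (simp add: o_def)

lemma continuous_map_coordinates:
  fixes Z :: "'a topology"
  defines "Z4 \<equiv> prod_topology Z (prod_topology Z (prod_topology Z Z))"
  shows "continuous_map Z4 Z fst" "continuous_map Z4 Z (\<lambda>p. fst (snd p))"
    "continuous_map Z4 Z (\<lambda>p. fst (snd (snd p)))" "continuous_map Z4 Z (\<lambda>p. snd (snd (snd p)))"
  unfolding Z4_def
  by (rule continuous_map_fst continuous_map_of_snd[OF continuous_map_fst]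
      continuous_map_of_snd[OF continuous_map_of_snd[OF continuous_map_fst]]
      continuous_map_of_snd[OF continuous_map_of_snd[OF continuous_map_snd]])+

lemma median_algebra_from_dense:
  fixes Y :: "'b topology"
  assumes A: "median_algebra X m" and \<nu>: "\<nu> \<in> X \<rightarrow> topspace Y"
    and dense: "Y closure_of (\<nu> ` X) = topspace Y" and Y: "Hausdorff_space Y"
    and cont: "continuous_map (prod_topology Y (prod_topology Y Y)) Y (\<lambda>(x, y, z). n x y z)"
    and ext: "\<And>x y z. \<lbrakk>x \<in> X; y \<in> X; z \<in> X\<rbrakk> \<Longrightarrow> n (\<nu> x) (\<nu> y) (\<nu> z) = \<nu> (m x y z)"
  shows "topological_median_algebra Y n"
proof -
  interpret median_algebra X m by (rule A)
  have n: "continuous_map W Y (\<lambda>w. n (p w) (q w) (r w))"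
    if "continuous_map W Y p" "continuous_map W Y q" "continuous_map W Y r"
    for W :: "('b \<times> 'b \<times> 'b \<times> 'b) topology" and p q r
  proof -
    have "continuous_map W (prod_topology Y (prod_topology Y Y)) (\<lambda>w. (p w, q w, r w))"
      by (intro continuous_map_pairedI that)
    from continuous_map_compose[OF this cont] show ?thesis by (simp add: o_def)
  qed
  note identity = identity_from_dense[OF dense Y]
  have "median_algebra (topspace Y) n"
  proof
    fix a b c x assume abc: "a \<in> topspace Y" "b \<in> topspace Y" "c \<in> topspace Y"
    show "n a b c \<in> topspace Y"
      using continuous_map_funspace[OF cont] abc by (force simp: Pi_iff)
    show "n a b c = n b a c"
      by (rule identity[where f = "\<lambda>a b c d. n a b c" and g = "\<lambda>a b c d. n b a c", OF _ _ _ abc abc(1)])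
        (auto intro!: n continuous_map_coordinates simp: ext sym12)
    show "n a b c = n a c b"
      by (rule identity[where f = "\<lambda>a b c d. n a b c" and g = "\<lambda>a b c d. n a c b", OF _ _ _ abc abc(1)])
        (auto intro!: n continuous_map_coordinates simp: ext sym23)
    show "n a b b = b"
      by (rule identity[where f = "\<lambda>a b c d. n a b b" and g = "\<lambda>a b c d. b", OF _ _ _ abc abc(1)])
        (auto intro!: n continuous_map_coordinates simp: ext majority)
    assume "x \<in> topspace Y"
    then show "n (n a x b) x c = n a x (n b x c)"
      by (intro identity[where f = "\<lambda>a b c x. n (n a x b) x c" and g = "\<lambda>a b c x. n a x (n b x c)",
            OF _ _ _ abc])
        (auto intro!: n continuous_map_coordinates simp: ext closed assoc)
  qed
  then show ?thesis using cont by (simp add: topological_median_algebra_def)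
qed

lemma median_hom_from_dense:
  fixes K :: "'k topology"
  assumes K: "topological_median_algebra K n" and Y: "topological_median_algebra Y n'" "Hausdorff_space Y"
    and \<eta>: "\<eta> \<in> X \<rightarrow> topspace K" and dense: "K closure_of (\<eta> ` X) = topspace K"
    and f: "continuous_map K Y f"
    and hom: "\<And>x y z. \<lbrakk>x \<in> X; y \<in> X; z \<in> X\<rbrakk>
      \<Longrightarrow> f (n (\<eta> x) (\<eta> y) (\<eta> z)) = n' (f (\<eta> x)) (f (\<eta> y)) (f (\<eta> z))"
  shows "median_hom (topspace K) n (topspace Y) n' f"
  unfolding median_hom_def
proof (intro conjI ballI)
  show "f \<in> topspace K \<rightarrow> topspace Y"
    using continuous_map_funspace[OF f] .
  note coords = continuous_map_coordinates[of K]
  have comp: "continuous_map W Y (\<lambda>w. f (p w))" if "continuous_map W K p"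
    for W :: "('k \<times> 'k \<times> 'k \<times> 'k) topology" and p
    using continuous_map_compose[OF that f] by (simp add: o_def)
  fix a b c assume abc: "a \<in> topspace K" "b \<in> topspace K" "c \<in> topspace K"
  show "f (n a b c) = n' (f a) (f b) (f c)"
    by (rule identity_from_dense[where f = "\<lambda>a b c d. f (n a b c)" and g = "\<lambda>a b c d. n' (f a) (f b) (f c)",
          OF dense Y(2) _ _ _ abc abc(1)])
      (auto intro!: comp continuous_map_median[OF K] continuous_map_median[OF Y(1)] coords simp: hom)
qed

lemma dense_image_surjective:
  assumes "compact_space K" "Hausdorff_space Y" "continuous_map K Y f"
    and "D \<subseteq> f ` topspace K" "Y closure_of D = topspace Y"
  shows "f ` topspace K = topspace Y"
proof
  show "f ` topspace K \<subseteq> topspace Y"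
    using assms(3) by (rule continuous_map_image_subset_topspace)
  have "compactin Y (f ` topspace K)"
    using assms(1,3) by (simp add: image_compactin compact_space_def)
  then have "closedin Y (f ` topspace K)"
    using assms(2) compactin_imp_closedin by blast
  then show "topspace Y \<subseteq> f ` topspace K"
    using assms(4,5) closure_of_minimal by metis
qed


section \<open>The minimal median compactification\<close>

context median_algebra
begin

lemma completion_median_exists:
  "\<exists>mh. topological_median_algebra branches.completion_space mh \<and>
    median_hom X m (topspace branches.completion_space) mh branches.embed"
proof -
  have "\<exists>mh. continuous_map (prod_topology branches.completion_space
        (prod_topology branches.completion_space branches.completion_space))
      branches.completion_space (\<lambda>(F, G, H). mh F G H) \<and>
    (\<forall>x\<in>X. \<forall>y\<in>X. \<forall>z\<in>X.
      mh (branches.embed x) (branches.embed y) (branches.embed z) = branches.embed (m x y z))"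
    by (rule branches.ternary_extension) (erule (2) closed, erule (4) branch_two_of_three)
  then obtain mh where mh: "continuous_map (prod_topology branches.completion_space
        (prod_topology branches.completion_space branches.completion_space))
      branches.completion_space (\<lambda>(F, G, H). mh F G H)"
    and ext: "\<forall>x\<in>X. \<forall>y\<in>X. \<forall>z\<in>X.
      mh (branches.embed x) (branches.embed y) (branches.embed z) = branches.embed (m x y z)"
    by blast
  have emb: "branches.embed \<in> X \<rightarrow> topspace branches.completion_space"
    using branches.embed_in_completion by (simp add: branches.topspace_completion_space)
  have "topological_median_algebra branches.completion_space mh"
    by (rule median_algebra_from_dense[OF median_algebra_axioms emb branches.dense_embed
          branches.Hausdorff_completion_space mh]) (use ext in blast)
  moreover have "median_hom X m (topspace branches.completion_space) mh branches.embed"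
    using emb ext by (simp add: median_hom_def)
  ultimately show ?thesis by blast
qed

lemma topological_median_algebra_embedded:
  assumes T: "topspace T = X" and Y: "topological_median_algebra Y n"
    and emb: "embedding_map T Y \<nu>" and hom: "median_hom X m (topspace Y) n \<nu>"
  shows "topological_median_algebra T m"
proof -
  obtain g where g: "homeomorphic_maps T (subtopology Y (\<nu> ` X)) \<nu> g"
    using emb T by (auto simp: embedding_map_def homeomorphic_map_maps)
  let ?T3 = "prod_topology T (prod_topology T T)"
  have \<nu>: "continuous_map T Y \<nu>"
    using g by (auto simp: homeomorphic_maps_def continuous_map_in_subtopology)
  have c: "continuous_map ?T3 T fst" "continuous_map ?T3 T (\<lambda>p. fst (snd p))" "continuous_map ?T3 T (\<lambda>p. snd (snd p))"
    by (rule continuous_map_fst continuous_map_of_snd[OF continuous_map_fst]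
        continuous_map_of_snd[OF continuous_map_snd])+
  have \<nu>c: "continuous_map ?T3 Y (\<lambda>p. \<nu> (h p))" if "continuous_map ?T3 T h" for h
    using continuous_map_compose[OF that \<nu>] by (simp add: o_def)
  have "continuous_map ?T3 Y (\<lambda>p. n (\<nu> (fst p)) (\<nu> (fst (snd p))) (\<nu> (snd (snd p))))"
    by (intro continuous_map_median[OF Y] \<nu>c c)
  then have "continuous_map ?T3 Y (\<lambda>p. \<nu> (m (fst p) (fst (snd p)) (snd (snd p))))"
    by (rule continuous_map_eq) (use hom T in \<open>auto simp: median_hom_def\<close>)
  then have "continuous_map ?T3 (subtopology Y (\<nu> ` X)) (\<lambda>p. \<nu> (m (fst p) (fst (snd p)) (snd (snd p))))"
    using closed T by (auto simp: continuous_map_in_subtopology)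
  moreover have "continuous_map (subtopology Y (\<nu> ` X)) T g"
    using g by (simp add: homeomorphic_maps_def)
  ultimately have "continuous_map ?T3 T (\<lambda>p. g (\<nu> (m (fst p) (fst (snd p)) (snd (snd p)))))"
    using continuous_map_compose by (fastforce simp: o_def)
  then have "continuous_map ?T3 T (\<lambda>(x, y, z). m x y z)"
    by (rule continuous_map_eq) (use g T closed in \<open>auto simp: homeomorphic_maps_def\<close>)
  then show ?thesis
    using T median_algebra_axioms by (simp add: topological_median_algebra_def)
qed

text \<open>The retraction of \<open>K\<close> given by \<open>k \<mapsto> n (\<eta> u) k (\<eta> v)\<close> is continuous and extends the retraction of \<open>X\<close> to
  \<open>[u, v]\<close>. Each point of \<open>K\<close> avoids one of the distinct values \<open>\<eta> u\<close> and \<open>\<eta> v\<close>, so the two open sets on which a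
  value is avoided cover \<open>K\<close>.\<close>

lemma branches_split_compactification:
  assumes K: "topological_median_algebra K n" and haus: "Hausdorff_space K"
    and hom: "median_hom X m (topspace K) n \<eta>" and inj: "inj_on \<eta> X"
    and AB: "(A, B) \<in> branch_pairs"
  shows "\<exists>V W. openin K V \<and> openin K W \<and> V \<union> W = topspace K \<and>
      (\<forall>x\<in>X. (\<eta> x \<in> V \<longrightarrow> x \<in> A) \<and> (\<eta> x \<in> W \<longrightarrow> x \<in> B))"
proof -
  obtain u v where A: "A = branch X m u v" "B = branch X m v u" and uv: "nontrivial_chain_interval X m u v"
    using AB by (auto simp: branch_pairs_def)
  have X: "u \<in> X" "v \<in> X" "u \<noteq> v" using uv by (auto simp: nontrivial_chain_interval_def)
  have \<eta>X: "\<eta> u \<in> topspace K" "\<eta> v \<in> topspace K" using hom X by (auto simp: median_hom_def)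
  define \<phi> where "\<phi> = (\<lambda>k. n (\<eta> u) k (\<eta> v))"
  have \<phi>: "continuous_map K K \<phi>"
    unfolding \<phi>_def by (rule continuous_map_median[OF K]) (use \<eta>X in auto)
  define V where "V = {k \<in> topspace K. \<phi> k \<in> topspace K - {\<eta> v}}"
  define W where "W = {k \<in> topspace K. \<phi> k \<in> topspace K - {\<eta> u}}"
  have op: "openin K (topspace K - {y})" if "y \<in> topspace K" for y
    using closedin_Hausdorff_singleton[OF haus that] by (simp add: closedin_def)
  have "openin K V" "openin K W"
    unfolding V_def W_def by (rule openin_continuous_map_preimage[OF \<phi> op], rule \<eta>X)+
  moreover have "\<eta> u \<noteq> \<eta> v" using inj X by (auto simp: inj_on_def)
  then have "V \<union> W = topspace K"
    using continuous_map_funspace[OF \<phi>] by (auto simp: V_def W_def)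
  moreover have "(\<eta> x \<in> V \<longrightarrow> x \<in> A) \<and> (\<eta> x \<in> W \<longrightarrow> x \<in> B)" if x: "x \<in> X" for x
  proof -
    have "\<phi> (\<eta> x) = \<eta> (m u x v)" using hom X x by (simp add: \<phi>_def median_hom_def)
    moreover have "m v x u = m u x v" using X x by (simp add: sym13)
    ultimately show ?thesis using x by (auto simp: A V_def W_def branch_def)
  qed
  ultimately show ?thesis by blast
qed

end

theorem theorem4p2:
  fixes X :: "'a set" and m :: "'a \<Rightarrow> 'a \<Rightarrow> 'a \<Rightarrow> 'a"
  defines "T \<equiv> median_topology X m"
    and "Xh \<equiv> completion_topology X (median_uniformity X m)"
    and "\<nu> \<equiv> completion_map X (median_uniformity X m)"
  assumes "median_algebra X m" and "T2_median X m"
  shows "compact_space Xh \<and> Hausdorff_space Xh \<and>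
    (\<exists>mh. topological_median_algebra Xh mh \<and> median_hom X m (topspace Xh) mh \<nu>) \<and>
    (\<forall>mh. topological_median_algebra Xh mh \<and> median_hom X m (topspace Xh) mh \<nu> \<longrightarrow>
      proper_median_compactification T m Xh mh \<nu> \<and>
      (\<forall>(K :: 'k topology) n \<eta>. proper_median_compactification T m K n \<eta> \<longrightarrow>
        (\<exists>!f. f \<in> extensional (topspace K) \<and>
          continuous_map K Xh f \<and> f ` topspace K = topspace Xh \<and>
          median_hom (topspace K) n (topspace Xh) mh f \<and>
          (\<forall>x\<in>X. f (\<eta> x) = \<nu> x))))"
proof -
  interpret median_algebra X m by fact
  have T: "T = uniform_topology X branches.pair_uniformity"
    by (simp add: T_def median_topology_def median_uniformity_eq)
  have Xh: "Xh = branches.completion_space"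
    by (simp add: Xh_def median_uniformity_eq)
  have \<nu>: "\<nu> = branches.embed"
    by (simp add: \<nu>_def median_uniformity_eq)
  have topT: "topspace T = X"
    by (simp add: T_def topspace_median_topology)
  have compact: "compact_space Xh" and haus: "Hausdorff_space Xh"
    and dense: "Xh closure_of (\<nu> ` X) = topspace Xh" and cont: "continuous_map T Xh \<nu>"
    unfolding T Xh \<nu> by (rule branches.compact_completion_space branches.Hausdorff_completion_space
        branches.dense_embed branches.continuous_map_embed)+
  have emb: "embedding_map T Xh \<nu>"
    unfolding T Xh \<nu> by (rule branches.embedding_map_embed[OF T2_separating[OF assms(5)]])
  have proper: "proper_median_compactification T m Xh mh \<nu>"
    if "topological_median_algebra Xh mh" "median_hom X m (topspace Xh) mh \<nu>" for mh
    unfolding proper_median_compactification_def median_compactification_def topT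
    using that compact haus dense cont emb topological_median_algebra_embedded[OF topT that(1) emb that(2)]
    by simp
  have unique: "\<exists>!f. f \<in> extensional (topspace K) \<and> continuous_map K Xh f \<and> f ` topspace K = topspace Xh \<and>
      median_hom (topspace K) n (topspace Xh) mh f \<and> (\<forall>x\<in>X. f (\<eta> x) = \<nu> x)"
    if mh: "topological_median_algebra Xh mh" "median_hom X m (topspace Xh) mh \<nu>"
      and K: "proper_median_compactification T m K n \<eta>" for mh and K :: "'k topology" and n \<eta>
  proof -
    have Kalg: "topological_median_algebra K n" and Kcomp: "compact_space K" and Khaus: "Hausdorff_space K"
      and hom: "median_hom X m (topspace K) n \<eta>" and Kdense: "K closure_of (\<eta> ` X) = topspace K"
      and Kemb: "embedding_map T K \<eta>"
      using K by (auto simp: proper_median_compactification_def median_compactification_def topT)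
    have \<eta>: "\<eta> \<in> X \<rightarrow> topspace K" using hom by (simp add: median_hom_def)
    have inj: "inj_on \<eta> X"
      using Kemb topT by (auto simp: embedding_map_def homeomorphic_eq_everything_map)
    obtain f0 where f0: "continuous_map K Xh f0" "\<forall>x\<in>X. f0 (\<eta> x) = \<nu> x"
      using branches.continuous_extension[OF \<eta> Kdense branches_split_compactification[OF Kalg Khaus hom inj]]
      unfolding Xh \<nu> by blast
    \<comment> \<open>Off the carrier of \<open>K\<close> the map must be \<open>undefined\<close>, or it would not be unique.\<close>
    define f where "f = restrict f0 (topspace K)"
    have f: "continuous_map K Xh f"
      by (rule continuous_map_eq[OF f0(1)]) (simp add: f_def)
    have f\<eta>: "f (\<eta> x) = \<nu> x" if "x \<in> X" for x
      using that f0(2) \<eta> by (auto simp: f_def Pi_iff)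
    have "\<nu> ` X \<subseteq> f ` topspace K"
      using f\<eta> \<eta> by (metis (no_types, lifting) Pi_iff image_subsetI imageI)
    then have surj: "f ` topspace K = topspace Xh"
      by (rule dense_image_surjective[OF Kcomp haus f _ dense])
    have fhom: "median_hom (topspace K) n (topspace Xh) mh f"
    proof (rule median_hom_from_dense[OF Kalg mh(1) haus \<eta> Kdense f])
      fix x y z assume xyz: "x \<in> X" "y \<in> X" "z \<in> X"
      then have "f (n (\<eta> x) (\<eta> y) (\<eta> z)) = f (\<eta> (m x y z))"
        using hom by (simp add: median_hom_def)
      also have "\<dots> = mh (\<nu> x) (\<nu> y) (\<nu> z)"
        using xyz mh(2) f\<eta> closed by (simp add: median_hom_def)
      finally show "f (n (\<eta> x) (\<eta> y) (\<eta> z)) = mh (f (\<eta> x)) (f (\<eta> y)) (f (\<eta> z))"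
        using xyz f\<eta> by simp
    qed
    show ?thesis
    proof (rule ex1I[of _ f])
      show "f \<in> extensional (topspace K) \<and> continuous_map K Xh f \<and> f ` topspace K = topspace Xh \<and>
          median_hom (topspace K) n (topspace Xh) mh f \<and> (\<forall>x\<in>X. f (\<eta> x) = \<nu> x)"
        using f surj fhom f\<eta> by (simp add: f_def)
    next
      fix g assume g: "g \<in> extensional (topspace K) \<and> continuous_map K Xh g \<and> g ` topspace K = topspace Xh \<and>
          median_hom (topspace K) n (topspace Xh) mh g \<and> (\<forall>x\<in>X. g (\<eta> x) = \<nu> x)"
      show "g = f"
      proof (rule extensionalityI[of _ "topspace K"])
        fix k assume "k \<in> topspace K"
        then have "k \<in> K closure_of (\<eta> ` X)" using Kdense by simp
        then show "g k = f k"
          by (rule forall_in_closure_of_eq[OF _ haus]) (use g f f\<eta> in auto)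
      qed (use g in \<open>auto simp: f_def\<close>)
    qed
  qed
  have ex: "\<exists>mh. topological_median_algebra Xh mh \<and> median_hom X m (topspace Xh) mh \<nu>"
    unfolding Xh \<nu> by (rule completion_median_exists)
  show ?thesis
  proof (intro conjI compact haus ex allI impI)
    fix mh assume mh: "topological_median_algebra Xh mh \<and> median_hom X m (topspace Xh) mh \<nu>"
    show "proper_median_compactification T m Xh mh \<nu>"
      by (rule proper[OF conjunct1[OF mh] conjunct2[OF mh]])
  next
    fix mh and K :: "'k topology" and n \<eta>
    assume mh: "topological_median_algebra Xh mh \<and> median_hom X m (topspace Xh) mh \<nu>"
      and K: "proper_median_compactification T m K n \<eta>"
    show "\<exists>!f. f \<in> extensional (topspace K) \<and> continuous_map K Xh f \<and> f ` topspace K = topspace Xh \<and>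
        median_hom (topspace K) n (topspace Xh) mh f \<and> (\<forall>x\<in>X. f (\<eta> x) = \<nu> x)"
      by (rule unique[OF conjunct1[OF mh] conjunct2[OF mh] K])
  qed
qed

end
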